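(* There exist an absolute constant $c>0$ and, for every $n\in\mathbb{N}$, a subfamily $\mathcal{T}^*_n\subseteq\mathcal{T}_n$ with $|\mathcal{T}^*_n|=(1-o(1))|\mathcal{T}_n|$ such that the random graph $G(n,p)$ with $p\ge c\,n^{-1/3}\log^2 n$ is asymptotically almost surely universal for $\mathcal{T}^*_n$.
   Context: $\mathcal{T}_n$ is the family of all labeled trees on vertex set $\{1,\dots,n\}$. $G(n,p)$ is the binomial random graph on $n$ vertices (each pair is an edge independently with probability $p$). A graph is universal for a family if it contains a copy (as a subgraph) of every member. "Asymptotically almost surely" means with probability tending to $1$ as $n\to\infty$; $o(1)$ is a quantity tending to $0$ as $n\to\infty$. $\log$ is the natural logarithm. *)

theory Defs
  imports "HOL-Probability.Probability"
begin

type_synonym 'a graph = "'a set \<times> 'a set set"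

definition all_pairs :: "'a set \<Rightarrow> 'a set set" where
  "all_pairs V = {e. e \<subseteq> V \<and> card e = 2}"

definition simple_graph :: "'a graph \<Rightarrow> bool" where
  "simple_graph = (\<lambda>(V, E). finite V \<and> E \<subseteq> all_pairs V)"

definition connected_graph :: "'a graph \<Rightarrow> bool" where
  "connected_graph = (\<lambda>(V, E).
     V \<noteq> {} \<and> (\<forall>u\<in>V. \<forall>v\<in>V. (\<lambda>x y. {x, y} \<in> E)\<^sup>*\<^sup>* u v))"

text \<open>A cycle is given by its vertices in cyclic order; the edge from the last
  vertex back to the first is required separately.\<close>

definition is_cycle :: "'a graph \<Rightarrow> 'a list \<Rightarrow> bool" where
  "is_cycle = (\<lambda>(V, E) vs. length vs \<ge> 3 \<and> distinct vs \<and> set vs \<subseteq> V \<and>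
     successively (\<lambda>x y. {x, y} \<in> E) vs \<and> {last vs, hd vs} \<in> E)"

definition is_tree :: "'a graph \<Rightarrow> bool" where
  "is_tree G \<longleftrightarrow> simple_graph G \<and> connected_graph G \<and> (\<nexists>vs. is_cycle G vs)"

text \<open>Trees are counted as labeled graphs, not up to isomorphism.\<close>

definition labeled_trees :: "nat \<Rightarrow> nat graph set" where
  "labeled_trees n = {T. fst T = {1..n} \<and> is_tree T}"

text \<open>A copy is a subgraph, not necessarily an induced one.\<close>

definition contains_copy :: "'a graph \<Rightarrow> 'b graph \<Rightarrow> bool" where
  "contains_copy = (\<lambda>(V, E) (W, F).
     \<exists>f. inj_on f W \<and> f ` W \<subseteq> V \<and> (\<forall>e\<in>F. f ` e \<in> E))"

definition universal_for :: "'a graph \<Rightarrow> 'b graph set \<Rightarrow> bool" where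
  "universal_for G \<F> \<longleftrightarrow> (\<forall>H\<in>\<F>. contains_copy G H)"

text \<open>The independent Bernoulli variables are indexed by the pairs of vertices;
  the value \<open>False\<close> is the irrelevant default outside this index set.\<close>

definition random_graph :: "nat \<Rightarrow> real \<Rightarrow> nat graph pmf" where
  "random_graph n p =
     map_pmf (\<lambda>X. ({1..n}, {e \<in> all_pairs {1..n}. X e}))
       (Pi_pmf (all_pairs {1..n}) False (\<lambda>_. bernoulli_pmf p))"

end

theory Submission
  imports Defs "HOL-Real_Asymp.Real_Asymp"
begin

text \<open>
  A tree rooted at 1 is its parent function. Call a non-root vertex a twig if its only child is a
  leaf. Switchings (local changes of the parent function, counted in both directions) show that
  almost all trees have at least $n^{7/8}$ twigs and at most $n^{1/6}+1$ children at every vertex.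

  In the random graph, with $s \approx n^{1/3}/\log n$, there is an edge between any two disjoint
  $s$-sets, and every vertex has a neighbour in each of the fixed intervals of length $s$ that do
  not contain it. Reserve unions of such intervals $X$, $Y$, $Z$ of sizes about $2s^2$, $s^2$ and
  $\Delta s^2$. Embed the tree without the leaves of the twigs greedily and off $Y$: a twig goes to
  $X$ if possible, and otherwise a vertex goes to the unreserved part if possible and to $Z$ if not.
  Fewer than $s$ image vertices have lost all their unreserved neighbours, so at most $\Delta s$
  vertices need $Z$; likewise fewer than $s$ vertices of $X$ are not covered by twigs. Hence every
  unused vertex keeps $s$ neighbours among the twigs, every twig has $s$ neighbours in $Y$, which is
  unused, and Hall's theorem places the remaining leaves.
\<close>

section \<open>Parent functions of rooted trees\<close>

text \<open>All randomness is spent before a tree is chosen: the two edge conditions do not mention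
  the tree, and every good tree embeds deterministically into a graph that satisfies them. No union
  bound over trees is made.

  The obstacle is that the copy is spanning, while a greedy embedding needs at least
  \<open>s\<close> free unreserved vertices throughout. Something must be kept for the end, and
  leaves of twigs are suited: each twig lacks exactly one neighbour, so the completion is a perfect
  matching. Therefore the twigs, not their leaves, are steered into a fixed set \<open>X\<close> in
  which every vertex has many neighbours.

  Leaves serve as an intermediate quantity in the count, since a twig is created by moving one leaf
  below another. With a threshold \<open>J\<close> for leaves and \<open>g\<close> for twigs, the
  proportion of trees with few leaves is about J / n, that of trees with many leaves but few twigs
  about g n / J^2, and that of trees with a large degree at most n / \<Delta>!. All three must
  vanish while \<Delta> s^2 stays below \<open>g\<close>.\<close>

text \<open>The rank \<open>h\<close> rules out cycles. Parent functions are \<open>undefined\<close> at the root, which is why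
  the root is excluded from \<open>children\<close>.\<close>

definition parent_funs :: "'a set \<Rightarrow> 'a \<Rightarrow> ('a \<Rightarrow> 'a) set" where
  "parent_funs V r = {f \<in> (V - {r}) \<rightarrow>\<^sub>E V. \<exists>h::'a \<Rightarrow> nat. \<forall>x\<in>V - {r}. h (f x) < h x}"

definition children :: "'a set \<Rightarrow> 'a \<Rightarrow> ('a \<Rightarrow> 'a) \<Rightarrow> 'a \<Rightarrow> 'a set" where
  "children V r f v = {x \<in> V - {r}. f x = v}"

definition leaves :: "'a set \<Rightarrow> 'a \<Rightarrow> ('a \<Rightarrow> 'a) \<Rightarrow> 'a set" where
  "leaves V r f = {v \<in> V - {r}. children V r f v = {}}"

definition twigs :: "'a set \<Rightarrow> 'a \<Rightarrow> ('a \<Rightarrow> 'a) \<Rightarrow> 'a set" where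
  "twigs V r f = {v \<in> V - {r}. \<exists>l. children V r f v = {l} \<and> children V r f l = {}}"

definition parent_tree :: "'a set \<Rightarrow> 'a \<Rightarrow> ('a \<Rightarrow> 'a) \<Rightarrow> 'a graph" where
  "parent_tree V r f = (V, (\<lambda>x. {x, f x}) ` (V - {r}))"

lemma parent_funs_in:
  assumes "f \<in> parent_funs W r" "x \<in> W" "x \<noteq> r"
  shows "f x \<in> W"
  using assms unfolding parent_funs_def by blast

lemma parent_funs_rank:
  assumes "f \<in> parent_funs V r"
  obtains h :: "'a \<Rightarrow> nat" where "\<And>x. x \<in> V \<Longrightarrow> x \<noteq> r \<Longrightarrow> h (f x) < h x"
  using assms unfolding parent_funs_def by blast

lemma parent_tree_edge:
  "{x, y} \<in> snd (parent_tree V r f) \<longleftrightarrow> (x \<in> V \<and> x \<noteq> r \<and> f x = y) \<or> (y \<in> V \<and> y \<noteq> r \<and> f y = x)"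
  by (auto simp: parent_tree_def doubleton_eq_iff)

lemma parent_funs_reach_root:
  assumes f: "f \<in> parent_funs V r" and r: "r \<in> V" and x: "x \<in> V"
  shows "(\<lambda>x y. {x, y} \<in> snd (parent_tree V r f))\<^sup>*\<^sup>* x r"
proof -
  obtain h where h: "\<And>x. x \<in> V \<Longrightarrow> x \<noteq> r \<Longrightarrow> (h (f x) :: nat) < h x"
    using parent_funs_rank[OF f] by blast
  show ?thesis using x
  proof (induction "h x" arbitrary: x rule: less_induct)
    case less
    show ?case
    proof (cases "x = r")
      case False
      have "(\<lambda>x y. {x, y} \<in> snd (parent_tree V r f))\<^sup>*\<^sup>* (f x) r"
        using less h False parent_funs_in[OF f] by blast
      moreover have "{x, f x} \<in> snd (parent_tree V r f)" using less.prems False by (simp add: parent_tree_edge)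
      ultimately show ?thesis by (rule converse_rtranclp_into_rtranclp[rotated])
    qed simp
  qed
qed

text \<open>The predecessor and the successor in cyclic order differ because a cycle has length at
  least 3. Applied at a vertex of highest rank, this refutes cycles in a parent tree.\<close>

lemma is_cycle_neighbours:
  assumes c: "is_cycle (V, E) vs" and v: "v \<in> set vs"
  obtains a b where "a \<in> set vs" "b \<in> set vs" "a \<noteq> b" "{a, v} \<in> E" "{v, b} \<in> E"
proof -
  let ?n = "length vs"
  have n: "?n \<ge> 3" and d: "distinct vs" and l: "{last vs, hd vs} \<in> E"
    and s: "\<And>i. Suc i < ?n \<Longrightarrow> {vs ! i, vs ! Suc i} \<in> E"
    using c by (auto simp: is_cycle_def successively_conv_nth)
  obtain i where i: "i < ?n" "vs ! i = v" using v by (auto simp: in_set_conv_nth)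
  define j where "j = (if i = 0 then ?n - 1 else i - 1)"
  define k where "k = (if Suc i = ?n then 0 else Suc i)"
  have hl: "hd vs = vs ! 0" "last vs = vs ! (?n - 1)" 
  proof -
    have "vs \<noteq> []" using n by auto
    then show "hd vs = vs ! 0" "last vs = vs ! (?n - 1)" by (simp_all add: hd_conv_nth last_conv_nth)
  qed
  have jk: "j < ?n" "k < ?n" "j \<noteq> k" using i n by (auto simp: j_def k_def)
  have "{vs ! j, v} \<in> E"
    using s[of "i - 1"] i l hl by (auto simp: j_def)
  moreover have "{v, vs ! k} \<in> E"
  proof (cases "Suc i = ?n")
    case True
    then have "last vs = v" using hl(2) i by (metis diff_Suc_1)
    then show ?thesis using True l hl(1) by (simp add: k_def)
  next
    case False
    then show ?thesis using s[of i] i by (auto simp: k_def)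
  qed
  moreover have "vs ! j \<noteq> vs ! k" using d jk by (simp add: nth_eq_iff_index_eq)
  ultimately show ?thesis using that[of "vs ! j" "vs ! k"] jk by simp
qed

text \<open>At a vertex of highest rank on a cycle, no neighbour on the cycle can be a child, since
  children have larger rank. Both neighbours would then be its one parent.\<close>

lemma is_tree_parent_tree:
  assumes fin: "finite V" and r: "r \<in> V" and f: "f \<in> parent_funs V r"
  shows "is_tree (parent_tree V r f)"
proof -
  let ?E = "snd (parent_tree V r f)"
  have eq: "parent_tree V r f = (V, ?E)" by (simp add: parent_tree_def)
  obtain h where h: "\<And>x. x \<in> V \<Longrightarrow> x \<noteq> r \<Longrightarrow> (h (f x) :: nat) < h x"
    using parent_funs_rank[OF f] by blast
  have "?E \<subseteq> all_pairs V"
  proof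
    fix e assume "e \<in> ?E"
    then obtain x where x: "x \<in> V" "x \<noteq> r" "e = {x, f x}" by (auto simp: parent_tree_def)
    moreover have "f x \<noteq> x" using h[of x] x by auto
    ultimately show "e \<in> all_pairs V" using parent_funs_in[OF f, of x] by (auto simp: all_pairs_def)
  qed
  then have simple: "simple_graph (V, ?E)" using fin by (simp add: simple_graph_def)
  have "(\<lambda>x y. {x, y} \<in> ?E)\<^sup>*\<^sup>* u v" if "u \<in> V" "v \<in> V" for u v
  proof -
    have "symp (\<lambda>x y. {x, y} \<in> ?E)" by (auto simp: symp_def insert_commute)
    then have "symp (\<lambda>x y. {x, y} \<in> ?E)\<^sup>*\<^sup>*" by (rule symp_rtranclp)
    then have "(\<lambda>x y. {x, y} \<in> ?E)\<^sup>*\<^sup>* r v"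
      using parent_funs_reach_root[OF f r that(2)] by (rule sympD)
    then show ?thesis using parent_funs_reach_root[OF f r that(1)] by (rule rtranclp_trans[rotated])
  qed
  then have conn: "connected_graph (V, ?E)" using r by (auto simp: connected_graph_def)
  have "\<not> is_cycle (V, ?E) vs" for vs
  proof
    assume c: "is_cycle (V, ?E) vs"
    have vs: "set vs \<subseteq> V" "set vs \<noteq> {}" using c by (auto simp: is_cycle_def)
    have "Max (h ` set vs) \<in> h ` set vs" using vs by (intro Max_in) auto
    then obtain v where v: "v \<in> set vs" "h v = Max (h ` set vs)" by (metis imageE)
    have vmax: "h x \<le> h v" if "x \<in> set vs" for x using that v(2) by simp
    obtain a b where ab: "a \<in> set vs" "b \<in> set vs" "a \<noteq> b" "{a, v} \<in> ?E" "{v, b} \<in> ?E"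
      using is_cycle_neighbours[OF c v(1)] by blast
    have "f v = x" if "x \<in> set vs" "{v, x} \<in> ?E" for x
      using that h[of x] vmax[of x] unfolding parent_tree_edge by auto
    then have "f v = a" "f v = b" using ab by (auto simp: insert_commute)
    then show False using ab by simp
  qed
  then show ?thesis unfolding is_tree_def eq[symmetric] using simple conn eq by simp
qed

text \<open>If \<open>x\<close> and \<open>f x\<close> are adjacent in the tree of \<open>g\<close>
  but \<open>g x\<close> differs from \<open>f x\<close>, then \<open>g\<close> sends
  \<open>f x\<close> back to \<open>x\<close>. By induction on the rank, \<open>f\<close> agrees
  with \<open>g\<close> at \<open>f x\<close>, so \<open>f\<close> would swap the two vertices,
  against the rank.\<close>

lemma inj_on_parent_tree:
  shows "inj_on (parent_tree V r) (parent_funs V r)"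
proof (rule inj_onI)
  fix f g assume f: "f \<in> parent_funs V r" and g: "g \<in> parent_funs V r"
    and eq: "parent_tree V r f = parent_tree V r g"
  obtain h where h: "\<And>x. x \<in> V \<Longrightarrow> x \<noteq> r \<Longrightarrow> (h (f x) :: nat) < h x"
    using parent_funs_rank[OF f] by blast
  have "f x = g x" if "x \<in> V" "x \<noteq> r" for x
    using that
  proof (induction "h x" arbitrary: x rule: less_induct)
    case less
    have "{x, f x} \<in> snd (parent_tree V r g)"
      using less.prems eq[symmetric] by (simp add: parent_tree_edge)
    then consider "g x = f x" | "f x \<in> V" "f x \<noteq> r" "g (f x) = x"
      by (auto simp: parent_tree_edge)
    then show ?case
    proof cases
      case 2
      have "f (f x) = x" using less.hyps[of "f x"] h less.prems 2 by simp
      then show ?thesis using h[of x] h[of "f x"] less.prems 2 by simp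
    qed simp
  qed
  then show "f = g"
    using f g PiE_ext[of f "V - {r}" "\<lambda>_. V" g] by (simp add: parent_funs_def)
qed

section \<open>From trees to parent functions\<close>

lemma simple_path:
  assumes "R\<^sup>*\<^sup>* x y"
  obtains p where "p \<noteq> []" "hd p = x" "last p = y" "distinct p" "successively R p"
proof -
  have "\<exists>p. p \<noteq> [] \<and> hd p = x \<and> last p = y \<and> distinct p \<and> successively R p"
    using assms
  proof (induction rule: rtranclp_induct)
    case base
    show ?case by (rule exI[of _ "[x]"]) auto
  next
    case (step y z)
    then obtain p where p: "p \<noteq> []" "hd p = x" "last p = y" "distinct p" "successively R p" by blast
    show ?case
    proof (cases "z \<in> set p")
      case True
      \<comment> \<open>A revisited vertex is handled by cutting the path at its earlier
        visit.\<close>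
      then obtain p1 p2 where "p = p1 @ z # p2" by (meson split_list)
      then show ?thesis using p
        by (intro exI[of _ "p1 @ [z]"]) (auto simp: successively_append_iff hd_append split: if_splits)
    next
      case False
      then show ?thesis using p step.hyps
        by (intro exI[of _ "p @ [z]"]) (auto simp: successively_append_iff)
    qed
  qed
  then show ?thesis using that by blast
qed

text \<open>The parent of a vertex is a neighbour closer to the root. An edge missed by this choice
  would close a cycle with the path that joins its ends in the parent tree.\<close>

lemma tree_is_parent_tree:
  assumes T: "is_tree (V, E)" and r: "r \<in> V"
  shows "\<exists>f\<in>parent_funs V r. (V, E) = parent_tree V r f"
proof -
  let ?R = "\<lambda>x y. {x, y} \<in> E"
  have fin: "finite V" and EV: "E \<subseteq> all_pairs V"
    and conn: "\<And>u v. u \<in> V \<Longrightarrow> v \<in> V \<Longrightarrow> ?R\<^sup>*\<^sup>* u v"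
    and acyc: "\<And>vs. \<not> is_cycle (V, E) vs"
    using T by (auto simp: is_tree_def simple_graph_def connected_graph_def)
  \<comment> \<open>The distance to the root, which later serves as the rank.\<close>
  define d where "d = (\<lambda>x. LEAST k. (?R ^^ k) x r)"
  have dex: "(?R ^^ d x) x r" if x: "x \<in> V" for x
  proof -
    obtain k where "(?R ^^ k) x r" using rtranclp_imp_relpowp[OF conn[OF x r]] by blast
    then show ?thesis unfolding d_def by (rule LeastI)
  qed
  have dle: "d x \<le> k" if "(?R ^^ k) x r" for x k
    unfolding d_def using that by (rule Least_le)
  have EVD: "x \<in> V" "y \<in> V" "x \<noteq> y" if "{x, y} \<in> E" for x y

  proof -
    have "{x, y} \<subseteq> V \<and> card {x, y} = 2" using that EV unfolding all_pairs_def by blast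
    then show "x \<in> V" "y \<in> V" "x \<noteq> y" by auto
  qed
  have path_in: "set p \<subseteq> V" if "successively ?R p" "hd p \<in> V" for p
    using that by (induction p) (auto simp: successively_Cons dest: EVD(2))
  have "\<exists>y. {x, y} \<in> E \<and> d y < d x" if x: "x \<in> V" "x \<noteq> r" for x
  proof (cases "d x")
    case 0
    then show ?thesis using dex[OF x(1)] x by simp
  next
    case (Suc k)
    then have "(?R ^^ Suc k) x r" using dex[OF x(1)] by simp
    then obtain y where "{x, y} \<in> E" "(?R ^^ k) y r" by (meson relpowp_Suc_D2)
    then show ?thesis using dle[of k y] Suc by (intro exI[of _ y]) simp
  qed
  then obtain f0 where f0: "\<And>x. x \<in> V \<Longrightarrow> x \<noteq> r \<Longrightarrow> {x, f0 x} \<in> E \<and> d (f0 x) < d x" by metis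
  define f where "f = restrict f0 (V - {r})"
  have f1: "\<And>x. x \<in> V \<Longrightarrow> x \<noteq> r \<Longrightarrow> {x, f x} \<in> E \<and> d (f x) < d x" using f0 by (simp add: f_def)
  have f: "f \<in> parent_funs V r"
    unfolding parent_funs_def
  proof (intro CollectI conjI)
    have "f0 x \<in> V" if "x \<in> V - {r}" for x using f0[of x] EVD(2) that by blast
    then show "f \<in> (V - {r}) \<rightarrow>\<^sub>E V" by (simp add: f_def)
    show "\<exists>h::'a \<Rightarrow> nat. \<forall>x\<in>V - {r}. h (f x) < h x" using f1 by (intro exI[of _ d]) simp
  qed
  let ?F = "snd (parent_tree V r f)"
  have sub: "?F \<subseteq> E" using f1 by (auto simp: parent_tree_def)
  have "E \<subseteq> ?F"
  proof
    fix e assume e: "e \<in> E"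
    show "e \<in> ?F"
    proof (rule ccontr)
      assume ne: "e \<notin> ?F"
      obtain x y where xy: "e = {x, y}" using e EV by (auto simp: all_pairs_def card_2_iff)
      have V: "x \<in> V" "y \<in> V" "x \<noteq> y" using EVD e xy by auto
      have "(\<lambda>x y. {x, y} \<in> ?F)\<^sup>*\<^sup>* x y"
        using is_tree_parent_tree[OF fin r f] V unfolding is_tree_def connected_graph_def parent_tree_def by simp
      then obtain p where p: "p \<noteq> []" "hd p = x" "last p = y" "distinct p" "successively (\<lambda>x y. {x, y} \<in> ?F) p"
        by (rule simple_path)
      have "is_cycle (V, E) p"
        unfolding is_cycle_def split
      proof (intro conjI)
        show "distinct p" by (fact p)
        show "successively (\<lambda>x y. {x, y} \<in> E) p" using p(5) by (rule successively_mono) (use sub in auto)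
        then show "set p \<subseteq> V" using path_in V(1) p(2) by blast
        show "{last p, hd p} \<in> E" using e xy p by (simp add: insert_commute)
        \<comment> \<open>A path with one vertex would give \<open>x = y\<close>, and one with two
          would make \<open>e\<close> an edge of the parent tree.\<close>
        show "3 \<le> length p"
        proof (rule ccontr)
          assume "\<not> ?thesis"
          then consider a where "p = [a]" | a b where "p = [a, b]"
            using p(1) by (cases p; cases "tl p") (auto simp: Suc_le_eq)
          then show False using p V ne xy by cases auto
        qed
      qed
      then show False using acyc by blast
    qed
  qed
  then show ?thesis using sub f by (intro bexI[of _ f]) (auto simp: parent_tree_def)
qed

lemma labeled_trees_eq_parent_trees:
  assumes "n \<ge> 1"
  shows "labeled_trees n = parent_tree {1..n} 1 ` parent_funs {1..n} 1"
proof -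
  have "fst (parent_tree {1..n} 1 f) = {1..n}" for f by (simp add: parent_tree_def)
  then show ?thesis
    using is_tree_parent_tree[of "{1..n}" 1] tree_is_parent_tree[of "{1..n}" _ 1] assms
    unfolding labeled_trees_def by (fastforce simp: image_iff)
qed

section \<open>Switchings\<close>

text \<open>Double counting. \<open>Sigma A P\<close> consists of the objects with a choice of
  switching, and \<open>T\<close> returns the switched object with a record that suffices to undo
  it. \<open>A\<close> is rare when there are many more choices than records.\<close>

lemma card_le_by_switching:
  fixes T :: "'a \<times> 'b \<Rightarrow> 'c \<times> 'd"
  assumes fin: "finite A" "finite B" "\<And>a. a \<in> A \<Longrightarrow> finite (P a)" "\<And>b. b \<in> B \<Longrightarrow> finite (Q b)"
    and inj: "inj_on T (Sigma A P)" and into: "T ` Sigma A P \<subseteq> Sigma B Q"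
    and lower: "\<And>a. a \<in> A \<Longrightarrow> \<alpha> \<le> card (P a)" and upper: "\<And>b. b \<in> B \<Longrightarrow> card (Q b) \<le> \<beta>"
  shows "card A * \<alpha> \<le> card B * \<beta>"
proof -
  have "card A * \<alpha> \<le> (\<Sum>a\<in>A. card (P a))" using lower by (metis sum_bounded_below of_nat_id)
  also have "\<dots> = card (Sigma A P)" using fin by simp
  also have "\<dots> \<le> card (Sigma B Q)" using inj into fin by (intro card_inj_on_le) auto
  also have "\<dots> = (\<Sum>b\<in>B. card (Q b))" using fin by simp
  also have "\<dots> \<le> card B * \<beta>" using upper by (metis sum_bounded_above of_nat_id)
  finally show ?thesis .
qed

lemma finite_parent_funs: "finite V \<Longrightarrow> finite (parent_funs V r)"
  unfolding parent_funs_def by (rule finite_subset[of _ "(V - {r}) \<rightarrow>\<^sub>E V"]) (auto intro: finite_PiE)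

lemma finite_children: "finite V \<Longrightarrow> finite (children V r f v)"
  by (simp add: children_def)

lemma finite_leaves: "finite V \<Longrightarrow> finite (leaves V r f)"
  by (simp add: leaves_def)

lemma finite_twigs: "finite V \<Longrightarrow> finite (twigs V r f)"
  by (simp add: twigs_def)

lemma children_upd:
  assumes "l \<in> V" "l \<noteq> r"
  shows "children V r (f(l := p)) v = (if v = p then insert l (children V r f p) else children V r f v - {l})"
  using assms by (auto simp: children_def)

lemma parent_funsI:
  fixes h :: "'a \<Rightarrow> nat"
  assumes "f \<in> (V - {r}) \<rightarrow>\<^sub>E V" and "\<And>x. x \<in> V \<Longrightarrow> x \<noteq> r \<Longrightarrow> h (f x) < h x"
  shows "f \<in> parent_funs V r"
  using assms unfolding parent_funs_def by blast

lemma parent_funs_PiE: "f \<in> parent_funs V r \<Longrightarrow> f \<in> (V - {r}) \<rightarrow>\<^sub>E V"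
  by (simp add: parent_funs_def)

lemma upd_PiE:
  assumes "f \<in> (V - {r}) \<rightarrow>\<^sub>E V" "l \<in> V - {r}" "p \<in> V"
  shows "f(l := p) \<in> (V - {r}) \<rightarrow>\<^sub>E V"
  using assms by (auto simp: PiE_iff extensional_def)

text \<open>A leaf is nobody's parent, so its rank can be set above that of \<open>p\<close> without
  disturbing any other vertex.\<close>

lemma parent_funs_move_leaf:
  assumes f: "f \<in> parent_funs V r" and l: "l \<in> leaves V r f" and p: "p \<in> V" "p \<noteq> l"
  shows "f(l := p) \<in> parent_funs V r"
proof -
  obtain h where h: "\<And>x. x \<in> V \<Longrightarrow> x \<noteq> r \<Longrightarrow> (h (f x) :: nat) < h x"
    using parent_funs_rank[OF f] by blast
  have "f x \<noteq> l" if "x \<in> V" "x \<noteq> r" for x using l that by (auto simp: leaves_def children_def)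
  note not_l = this
  have lV: "l \<in> V - {r}" using l by (simp add: leaves_def)
  show ?thesis
  proof (rule parent_funsI[of _ _ _ "h(l := Suc (h p))"])
    show "f(l := p) \<in> (V - {r}) \<rightarrow>\<^sub>E V"
      using upd_PiE[OF parent_funs_PiE[OF f] lV p(1)] .
    show "(h(l := Suc (h p))) ((f(l := p)) x) < (h(l := Suc (h p))) x" if "x \<in> V" "x \<noteq> r" for x
      using not_l[OF that] h[OF that] p(2) by simp
  qed
qed

text \<open>The switching moves a leaf \<open>l\<close> below another leaf \<open>p\<close>, so that \<open>p\<close> becomes a twig with leaf \<open>l\<close>;
  it is undone by knowing the twig \<open>p\<close> and the old parent of \<open>l\<close>.\<close>

lemma card_few_twigs:
  assumes fin: "finite V"
  shows "card {f \<in> parent_funs V r. J \<le> card (leaves V r f) \<and> card (twigs V r f) \<le> g} * (J * (J - 1))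
    \<le> card (parent_funs V r) * ((g + 3) * card V)"
proof -
  let ?A = "{f \<in> parent_funs V r. J \<le> card (leaves V r f) \<and> card (twigs V r f) \<le> g}"
  \<comment> \<open>Only \<open>p\<close>, the old parent of \<open>l\<close> and the old
    grandparent of \<open>l\<close> can become twigs, hence the 3.\<close>
  let ?B = "{f \<in> parent_funs V r. card (twigs V r f) \<le> g + 3}"
  let ?P = "\<lambda>f. SIGMA l:leaves V r f. leaves V r f - {l}"
  let ?Q = "\<lambda>f. twigs V r f \<times> V"
  let ?T = "\<lambda>(f, (l, p)). (f(l := p), (p, f l :: 'a))"
  have new: "children V r (f(l := p)) p = {l}" "p \<in> twigs V r (f(l := p))"
    "twigs V r (f(l := p)) \<subseteq> twigs V r f \<union> {p, f l, f (f l)}"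
    if lp: "l \<in> leaves V r f" "p \<in> leaves V r f" "p \<noteq> l" for f l p
  proof -
    have l: "l \<in> V" "l \<noteq> r" "children V r f l = {}" and p: "p \<in> V" "p \<noteq> r" "children V r f p = {}"
      using lp by (auto simp: leaves_def)
    note upd = children_upd[OF l(1,2), of f p]
    show "children V r (f(l := p)) p = {l}" using p upd by simp
    then show "p \<in> twigs V r (f(l := p))"
      using p l lp(3) upd[of l] unfolding twigs_def by auto
    show "twigs V r (f(l := p)) \<subseteq> twigs V r f \<union> {p, f l, f (f l)}"
    proof
      fix v assume v: "v \<in> twigs V r (f(l := p))"
      show "v \<in> twigs V r f \<union> {p, f l, f (f l)}"
      proof (rule ccontr)
        assume nv: "\<not> ?thesis"
        obtain c where c: "children V r (f(l := p)) v = {c}" "children V r (f(l := p)) c = {}"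
          using v by (auto simp: twigs_def)
        \<comment> \<open>Away from these three vertices neither \<open>v\<close> nor its only child
          \<open>c\<close> loses the child \<open>l\<close>, and \<open>c\<close> is not
          \<open>p\<close>, which has a child now. So \<open>v\<close> was a twig before.\<close>
        have "l \<notin> children V r f v" using nv by (auto simp: children_def)
        then have cv: "children V r f v = {c}" using c(1) nv upd[of v] by simp
        then have "f c = v" by (auto simp: children_def)
        then have "l \<notin> children V r f c" using nv by (auto simp: children_def)
        moreover have "c \<noteq> p" using c(2) upd[of p] by auto
        ultimately have "children V r f c = {}" using c(2) upd[of c] by simp
        then show False using cv nv v by (auto simp: twigs_def)
      qed
    qed
  qed
  show ?thesis
  proof (rule order.trans[OF card_le_by_switching[where T = ?T and A = ?A and P = ?P and B = ?B and Q = ?Q]])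
    show "inj_on ?T (Sigma ?A ?P)"
    proof (rule inj_onI)
      fix a b assume ab: "a \<in> Sigma ?A ?P" "b \<in> Sigma ?A ?P" "?T a = ?T b"
      obtain f l p where a_eq: "a = (f, (l, p))" by (metis prod.exhaust)
      obtain g l' p' where b_eq: "b = (g, (l', p'))" by (metis prod.exhaust)
      have a: "l \<in> leaves V r f" "p \<in> leaves V r f" "p \<noteq> l" "l' \<in> leaves V r g" "p' \<in> leaves V r g" "p' \<noteq> l'"
        using ab(1,2) by (auto simp: a_eq b_eq)
      have eq: "f(l := p) = g(l' := p')" "p = p'" "f l = g l'"
        using ab(3) unfolding a_eq b_eq split prod.inject by blast+
      have "{l} = {l'}" using new(1)[OF a(1-3)] new(1)[OF a(4-6)] eq by simp
      then have "l = l'" by simp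
      moreover have "f = (f(l := p))(l := f l)" "g = (g(l' := p'))(l' := g l')" by simp_all
      ultimately have "f = g" using eq(1,3) by metis
      then show "a = b" using \<open>l = l'\<close> eq(2) by (simp add: a_eq b_eq)
    qed
    show "?T ` Sigma ?A ?P \<subseteq> Sigma ?B ?Q"
    proof (rule image_subsetI)
      fix a assume a: "a \<in> Sigma ?A ?P"
      obtain f l p where a_eq: "a = (f, (l, p))" by (metis prod.exhaust)
      have f: "f \<in> parent_funs V r" and tw: "card (twigs V r f) \<le> g"
        and lp: "l \<in> leaves V r f" "p \<in> leaves V r f" "p \<noteq> l"
        using a by (auto simp: a_eq)
      have "card (twigs V r (f(l := p))) \<le> card (twigs V r f \<union> {p, f l, f (f l)})"
        using new(3)[OF lp] fin by (intro card_mono) (auto simp: finite_twigs)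
      also have "\<dots> \<le> card (twigs V r f) + card {p, f l, f (f l)}" by (rule card_Un_le)
      also have "\<dots> \<le> g + 3" using tw by (simp add: card_insert_if)
      finally have "card (twigs V r (f(l := p))) \<le> g + 3" .
      moreover have "p \<in> V" "l \<in> V" "l \<noteq> r" using lp by (auto simp: leaves_def)
      moreover have "f(l := p) \<in> parent_funs V r" "f l \<in> V"
        using parent_funs_move_leaf[OF f lp(1)] lp(3) parent_funs_in[OF f, of l] calculation by auto
      ultimately show "?T a \<in> Sigma ?B ?Q"
        using new(2)[OF lp] by (simp add: a_eq)
    qed
    show "J * (J - 1) \<le> card (?P f)" if "f \<in> ?A" for f
    proof -
      let ?j = "card (leaves V r f)"
      have "card (?P f) = ?j * (?j - 1)" using fin by (simp add: finite_leaves)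
      moreover have "J * (J - 1) \<le> ?j * (?j - 1)" using that by (intro mult_le_mono) auto
      ultimately show ?thesis by simp
    qed
    show "card (?Q f) \<le> (g + 3) * card V" if "f \<in> ?B" for f
      using that by (simp add: card_cartesian_product)
    show "card ?B * ((g + 3) * card V) \<le> card (parent_funs V r) * ((g + 3) * card V)"
      using fin by (intro mult_le_mono card_mono finite_parent_funs) auto
  qed (use fin in \<open>auto simp: finite_parent_funs finite_leaves finite_twigs\<close>)
qed

text \<open>With L leaves there are at least n - 1 - L vertices that have children, and they share n
  - 1 children. So at least n - 1 - 2L of them have exactly one child, and discarding the root costs
  one more. The set lists the only children instead of their parents because the switching is
  described through the child.\<close>

lemma card_only_children_ge:
  assumes fin: "finite V" and r: "r \<in> V" and f: "f \<in> parent_funs V r"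
  shows "card V \<le> card {x \<in> V - {r}. f x \<noteq> r \<and> children V r f (f x) = {x}} + 2 * card (leaves V r f) + 2"
    (is "_ \<le> card ?X + _ + _")
proof -
  define I where "I = f ` (V - {r})"
  define O1 where "O1 = {v \<in> I. card (children V r f v) = 1}"
  have finI: "finite I" "finite O1" using fin by (auto simp: I_def O1_def)
  have IV: "I \<subseteq> V" using parent_funs_in[OF f] by (auto simp: I_def)
  have "leaves V r f = V - {r} - I" by (auto simp: leaves_def I_def children_def)
  then have "card (V - {r}) \<le> card (leaves V r f) + card I"
    using diff_card_le_card_Diff[OF finI(1), of "V - {r}"] by simp
  then have 1: "card V \<le> card (leaves V r f) + card I + 1" using fin r by (simp add: card_Diff_singleton)
  have "V - {r} = (\<Union>v\<in>I. children V r f v)" by (auto simp: I_def children_def)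
  moreover have "card (\<Union>v\<in>I. children V r f v) = (\<Sum>v\<in>I. card (children V r f v))"
    using fin finI by (intro card_UN_disjoint) (auto simp: children_def)
  ultimately have "card (V - {r}) = (\<Sum>v\<in>I. card (children V r f v))" by simp
  also have "\<dots> = (\<Sum>v\<in>O1. card (children V r f v)) + (\<Sum>v\<in>I - O1. card (children V r f v))"
    using finI by (subst sum.subset_diff[of O1 I]) (auto simp: O1_def)
  also have "(\<Sum>v\<in>O1. card (children V r f v)) = card O1" by (simp add: O1_def)
  finally have split: "card (V - {r}) = card O1 + (\<Sum>v\<in>I - O1. card (children V r f v))" .
  have "(\<Sum>v\<in>I - O1. 2) \<le> (\<Sum>v\<in>I - O1. card (children V r f v))"
  proof (rule sum_mono)
    fix v assume v: "v \<in> I - O1"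
    then have "children V r f v \<noteq> {}" by (auto simp: I_def children_def)
    then have "card (children V r f v) \<noteq> 0" using finite_children[OF fin] by (simp add: card_eq_0_iff)
    moreover have "card (children V r f v) \<noteq> 1" using v by (simp add: O1_def)
    ultimately show "2 \<le> card (children V r f v)" by linarith
  qed
  moreover have "card (I - O1) = card I - card O1"
    using finI by (intro card_Diff_subset) (auto simp: O1_def)
  ultimately have "card O1 + 2 * (card I - card O1) \<le> card (V - {r})" using split by simp
  moreover have "card V = Suc (card (V - {r}))" using fin r by (rule card.remove)
  ultimately have 2: "card V \<ge> card O1 + 2 * (card I - card O1) + 1" by simp
  have "O1 - {r} \<subseteq> f ` ?X"
  proof
    fix v assume v: "v \<in> O1 - {r}"
    then obtain x where x: "children V r f v = {x}" by (auto simp: O1_def card_1_singleton_iff)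
    then have "x \<in> children V r f v" by simp
    then have "x \<in> V - {r}" "f x = v" by (auto simp: children_def)
    then show "v \<in> f ` ?X" using x v by (intro image_eqI[of _ _ x]) auto
  qed
  then have "card (O1 - {r}) \<le> card ?X" using fin by (intro surj_card_le) auto
  moreover have "card O1 \<le> card (O1 - {r}) + 1"
    using diff_card_le_card_Diff[of "{r}" O1] by simp
  moreover have "card O1 \<le> card I" using finI by (intro card_mono) (auto simp: O1_def)
  ultimately show ?thesis using 1 2 by linarith
qed

text \<open>The switching suppresses a vertex \<open>y = f x\<close> whose only child is \<open>x\<close> and reattaches it as a leaf
  below any \<open>z\<close>; it is undone by inserting the leaf \<open>y\<close> into the edge above \<open>x\<close>.\<close>

lemma card_few_leaves:
  assumes fin: "finite V" and r: "r \<in> V"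
  shows "card {f \<in> parent_funs V r. card (leaves V r f) \<le> J} * ((card V - 2 - 2 * J) * (card V - 1))
    \<le> card (parent_funs V r) * ((J + 1) * card V)"
proof -
  let ?A = "{f \<in> parent_funs V r. card (leaves V r f) \<le> J}"
  \<comment> \<open>Only \<open>f x\<close> can become a leaf: its old parent receives the child
    \<open>x\<close> in exchange.\<close>
  let ?B = "{f \<in> parent_funs V r. card (leaves V r f) \<le> J + 1}"
  let ?X = "\<lambda>f. {x \<in> V - {r}. f x \<noteq> r \<and> children V r f (f x) = {x}}"
  \<comment> \<open>Even a \<open>z\<close> in the subtree of \<open>x\<close> is allowed: the
    suppressed vertex \<open>f x\<close> has no children left, so no cycle arises.\<close>
  let ?P = "\<lambda>f. SIGMA x:?X f. V - {f x}"
  let ?Q = "\<lambda>f. leaves V r f \<times> V"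
  let ?T = "\<lambda>(f, (x, z)). (f(x := f (f x), f x := z), (f x, x :: 'a))"
  have new: "f(x := f (f x), f x := z) \<in> parent_funs V r" "f x \<in> leaves V r (f(x := f (f x), f x := z))"
      "leaves V r (f(x := f (f x), f x := z)) \<subseteq> insert (f x) (leaves V r f)" "x \<noteq> f x"
    if f: "f \<in> parent_funs V r" and x: "x \<in> ?X f" and z: "z \<in> V" "z \<noteq> f x" for f x z
  proof -
    obtain h where h: "\<And>x. x \<in> V \<Longrightarrow> x \<noteq> r \<Longrightarrow> (h (f x) :: nat) < h x"
      using parent_funs_rank[OF f] by blast
    define y where "y = f x"
    have xV: "x \<in> V" "x \<noteq> r" and y: "y \<noteq> r" "children V r f y = {x}" using x by (auto simp: y_def)
    have yV: "y \<in> V" using parent_funs_in[OF f] xV by (simp add: y_def)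
    have fyV: "f y \<in> V" using parent_funs_in[OF f] yV y by simp
    have hx: "h y < h x" using h xV by (simp add: y_def)
    have hy: "h (f y) < h y" using h yV y by simp
    show xy: "x \<noteq> f x" using hx y_def by auto
    let ?f = "f(x := f y, y := z)"
    have only: "f u \<noteq> y" if "u \<in> V" "u \<noteq> r" "u \<noteq> x" for u
      using y(2) that by (auto simp: children_def)
    have noty: "?f u \<noteq> y" if "u \<in> V" "u \<noteq> r" for u
      using only[of u] that z hy by (auto simp: y_def)
    have "?f \<in> parent_funs V r"
    \<comment> \<open>Nothing has \<open>y\<close> as parent any more, so its rank is free to be set
      above \<open>z\<close>. The new parent of \<open>x\<close> is its old grandparent, whose rank
      is smaller still.\<close>
    proof (rule parent_funsI[of _ _ _ "h(y := Suc (h z))"])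
      show "?f \<in> (V - {r}) \<rightarrow>\<^sub>E V"
        using parent_funs_PiE[OF f] xV yV y fyV z by (intro upd_PiE) auto
      show "(h(y := Suc (h z))) (?f u) < (h(y := Suc (h z))) u" if "u \<in> V" "u \<noteq> r" for u
        using noty[OF that] h[OF that] hx hy z xy by (auto simp: y_def)
    qed
    then show "f(x := f (f x), f x := z) \<in> parent_funs V r" by (simp add: y_def)
    show "f x \<in> leaves V r (f(x := f (f x), f x := z))"
    proof -
      have "y \<in> leaves V r ?f" using noty yV y(1) unfolding leaves_def children_def by blast
      then show ?thesis by (simp add: y_def)
    qed
    show "leaves V r (f(x := f (f x), f x := z)) \<subseteq> insert (f x) (leaves V r f)"
    proof (rule subsetI, rule ccontr)
      fix v assume v: "v \<in> leaves V r (f(x := f (f x), f x := z))" "v \<notin> insert (f x) (leaves V r f)"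
      then obtain u where u: "u \<in> V" "u \<noteq> r" "f u = v" by (auto simp: leaves_def children_def)
      have nv: "?f w \<noteq> v" if "w \<in> V" "w \<noteq> r" for w
        using v(1) that by (auto simp: leaves_def children_def y_def)
      have "u \<noteq> x" using u v by auto
      moreover have "u \<noteq> y" using nv[OF xV] u(3) xy by (auto simp: y_def)
      ultimately show False using nv[OF u(1,2)] u(3) by simp
    qed
  qed
  show ?thesis
  proof (rule order.trans[OF card_le_by_switching[where T = ?T and A = ?A and P = ?P and B = ?B and Q = ?Q]])
    show "inj_on ?T (Sigma ?A ?P)"
    proof (rule inj_onI)
      fix a b assume ab: "a \<in> Sigma ?A ?P" "b \<in> Sigma ?A ?P" "?T a = ?T b"
      obtain f x z where a_eq: "a = (f, (x, z))" by (metis prod.exhaust)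
      obtain g x' z' where b_eq: "b = (g, (x', z'))" by (metis prod.exhaust)
      have f: "f \<in> parent_funs V r" and x: "x \<in> ?X f" and z: "z \<in> V" "z \<noteq> f x"
        using ab(1) by (simp_all add: a_eq)
      have g: "g \<in> parent_funs V r" and x': "x' \<in> ?X g" and z': "z' \<in> V" "z' \<noteq> g x'"
        using ab(2) by (simp_all add: b_eq)
      have eq: "f(x := f (f x), f x := z) = g(x' := g (g x'), g x' := z')" "f x = g x'" "x = x'"
        using ab(3) unfolding a_eq b_eq split prod.inject by blast+
      have "x \<noteq> f x" "x' \<noteq> g x'" using new(4)[OF f x z] new(4)[OF g x' z'] by blast+
      then have "f = (f(x := f (f x), f x := z))(f x := (f(x := f (f x), f x := z)) x, x := f x)"
        "g = (g(x' := g (g x'), g x' := z'))(g x' := (g(x' := g (g x'), g x' := z')) x', x' := g x')"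
        by (auto simp: fun_eq_iff)
      then have "f = g" using eq by metis
      moreover have "z = z'" using fun_cong[OF eq(1), of "f x"] eq(2) by simp
      ultimately show "a = b" using eq by (simp add: a_eq b_eq)
    qed
    show "?T ` Sigma ?A ?P \<subseteq> Sigma ?B ?Q"
    proof (rule image_subsetI)
      fix a assume a: "a \<in> Sigma ?A ?P"
      obtain f x z where a_eq: "a = (f, (x, z))" by (metis prod.exhaust)
      have f: "f \<in> parent_funs V r" and lv: "card (leaves V r f) \<le> J"
        and x': "x \<in> ?X f" and z: "z \<in> V" "z \<noteq> f x"
        using a by (simp_all add: a_eq)
      let ?f = "f(x := f (f x), f x := z)"
      have "card (leaves V r ?f) \<le> card (insert (f x) (leaves V r f))"
        using new(3)[OF f x' z] fin by (intro card_mono) (auto simp: finite_leaves)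
      also have "\<dots> \<le> J + 1" using lv fin by (simp add: card_insert_if finite_leaves)
      finally have "card (leaves V r ?f) \<le> J + 1" .
      then show "?T a \<in> Sigma ?B ?Q"
        using new(1,2)[OF f x' z] x' by (simp add: a_eq)
    qed
    show "(card V - 2 - 2 * J) * (card V - 1) \<le> card (?P f)" if "f \<in> ?A" for f
    proof -
      have "card (?P f) = (\<Sum>x\<in>?X f. card (V - {f x}))" using fin by simp
      also have "\<dots> = (\<Sum>x\<in>?X f. card V - 1)"
        using that fin parent_funs_in[of f V r] by (intro sum.cong) (auto simp: card_Diff_singleton)
      also have "\<dots> = card (?X f) * (card V - 1)" by simp
      finally have "card (?P f) = card (?X f) * (card V - 1)" .
      moreover have "card V - 2 - 2 * J \<le> card (?X f)"
      proof -
        have "f \<in> parent_funs V r" "card (leaves V r f) \<le> J" using that by simp_all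
        then show ?thesis using card_only_children_ge[OF fin r, of f] by linarith
      qed
      ultimately show ?thesis by (simp only: mult_le_mono1)
    qed
    show "card (?Q f) \<le> (J + 1) * card V" if "f \<in> ?B" for f
      using that unfolding card_cartesian_product by (intro mult_le_mono1) simp
    show "card ?B * ((J + 1) * card V) \<le> card (parent_funs V r) * ((J + 1) * card V)"
      using fin by (intro mult_le_mono card_mono finite_parent_funs) auto
  qed (use fin in \<open>auto simp: finite_parent_funs finite_leaves\<close>)
qed

section \<open>Subtrees, and vertices with many children\<close>

definition descends :: "'a set \<Rightarrow> 'a \<Rightarrow> ('a \<Rightarrow> 'a) \<Rightarrow> 'a \<Rightarrow> 'a \<Rightarrow> bool" where
  "descends V r f = (\<lambda>a b. a \<in> V - {r} \<and> f a = b)\<^sup>*\<^sup>*"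

text \<open>\<open>descends\<close> is reflexive and leads from a vertex to its ancestors. Parents
  are unique, so the ancestors of \<open>z\<close> form a chain.\<close>

lemma descends_comparable:
  assumes "descends V r f z y" "descends V r f z y'"
  shows "descends V r f y y' \<or> descends V r f y' y"
  using assms(1) unfolding descends_def
proof (induction rule: rtranclp_induct)
  case base
  then show ?case using assms(2) by (simp add: descends_def)
next
  case (step y u)
  from step.IH show ?case
  proof
    assume "(\<lambda>a b. a \<in> V - {r} \<and> f a = b)\<^sup>*\<^sup>* y y'"
    then show ?thesis
    proof (cases rule: converse_rtranclpE)
      case base
      then show ?thesis using step.hyps(2) by blast
    next
      case (step w)
      then show ?thesis using \<open>y \<in> V - {r} \<and> f y = u\<close> by blast
    qed
  next
    assume d: "(\<lambda>a b. a \<in> V - {r} \<and> f a = b)\<^sup>*\<^sup>* y' y"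
    show ?thesis using rtranclp.rtrancl_into_rtrancl[OF d step.hyps(2)] by blast
  qed
qed

lemma descends_rank:
  assumes h: "\<And>x. x \<in> V \<Longrightarrow> x \<noteq> r \<Longrightarrow> (h (f x) :: nat) < h x" and "descends V r f a b"
  shows "h b \<le> h a"
  using assms(2) unfolding descends_def
proof (induction rule: rtranclp_induct)
  case (step y z)
  then show ?case using h[of y] by auto
qed simp

text \<open>The first step from \<open>y\<close> leads to \<open>x\<close>, so \<open>y'\<close>
  would be \<open>x\<close> or an ancestor of \<open>x\<close>, although it has larger rank as a
  child of \<open>x\<close>.\<close>

lemma siblings_not_descend:
  assumes f: "f \<in> parent_funs V r" and y: "y \<in> children V r f x" "y' \<in> children V r f x" "y \<noteq> y'"
  shows "\<not> descends V r f y y'"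
proof
  assume d: "descends V r f y y'"
  obtain h where h: "\<And>x. x \<in> V \<Longrightarrow> x \<noteq> r \<Longrightarrow> (h (f x) :: nat) < h x"
    using parent_funs_rank[OF f] by blast
  from d[unfolded descends_def] have "descends V r f x y'"
  proof (cases rule: converse_rtranclpE)
    case (step w)
    then show ?thesis using y(1) by (auto simp: descends_def children_def)
  qed (use y in simp)
  then have "h y' \<le> h x" using descends_rank[of V r h f] h by blast
  moreover have "h x < h y'" using h[of y'] y(2) by (auto simp: children_def)
  ultimately show False by simp
qed

text \<open>The ranks in the subtree of \<open>y\<close> are lifted by \<open>h z + 1\<close>. This
  puts \<open>y\<close> above \<open>z\<close>, which lies outside the subtree and keeps its rank.
  Any other non-root vertex is in the subtree exactly when its parent is, so its inequality
  survives.\<close>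

lemma parent_funs_move_subtree:
  assumes f: "f \<in> parent_funs V r" and y: "y \<in> V" "y \<noteq> r" and z: "z \<in> V" "\<not> descends V r f z y"
  shows "f(y := z) \<in> parent_funs V r"
proof -
  obtain h where h: "\<And>x. x \<in> V \<Longrightarrow> x \<noteq> r \<Longrightarrow> (h (f x) :: nat) < h x"
    using parent_funs_rank[OF f] by blast
  define h' where "h' = (\<lambda>v. if descends V r f v y then h v + h z + 1 else h v)"
  have yy: "descends V r f y y" by (simp add: descends_def)
  show ?thesis
  proof (rule parent_funsI[of _ _ _ h'])
    show "f(y := z) \<in> (V - {r}) \<rightarrow>\<^sub>E V" using f y z by (intro upd_PiE parent_funs_PiE) auto
    show "h' ((f(y := z)) x) < h' x" if x: "x \<in> V" "x \<noteq> r" for x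
    proof (cases "x = y")
      case True
      then show ?thesis using z yy by (simp add: h'_def)
    next
      case False
      have "descends V r f x y \<longleftrightarrow> descends V r f (f x) y"
      proof
        assume "descends V r f x y"
        from this[unfolded descends_def] show "descends V r f (f x) y"
          by (cases rule: converse_rtranclpE) (use False in \<open>auto simp: descends_def\<close>)
      next
        assume "descends V r f (f x) y"
        then show "descends V r f x y"
          using x unfolding descends_def by (intro converse_rtranclp_into_rtranclp[of _ x "f x"]) auto
      qed
      then show ?thesis using h[OF x] False by (simp add: h'_def)
    qed
  qed
qed

text \<open>The switching moves a child \<open>y\<close> of \<open>x\<close>, with its subtree, below a vertex \<open>z\<close> outside that
  subtree. Siblings have disjoint subtrees, so each \<open>z\<close> excludes at most one child of \<open>x\<close>.\<close>

lemma card_many_children_step: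
  assumes fin: "finite V" and r: "r \<in> V" and x: "x \<in> V"
  shows "card {f \<in> parent_funs V r. Suc k \<le> card (children V r f x)} * ((card V - 1) * k)
    \<le> card {f \<in> parent_funs V r. k \<le> card (children V r f x)} * (card V - 1)"
proof -
  let ?A = "{f \<in> parent_funs V r. Suc k \<le> card (children V r f x)}"
  let ?B = "{f \<in> parent_funs V r. k \<le> card (children V r f x)}"
  let ?Y = "\<lambda>f z. {y \<in> children V r f x. \<not> descends V r f z y}"
  let ?P = "\<lambda>f. SIGMA z:V - {x}. ?Y f z"
  \<comment> \<open>The vertex \<open>y\<close> is record enough, since its old parent is always
    \<open>x\<close>. There are \<open>card V - 1\<close> records but at least \<open>k\<close>
    times as many choices, which is the gain.\<close>
  let ?Q = "\<lambda>f::'a \<Rightarrow> 'a. V - {r}"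
  let ?T = "\<lambda>(f, (z, y)). (f(y := z), y :: 'a)"
  show ?thesis
  proof (rule card_le_by_switching[where T = ?T and P = ?P and Q = ?Q])
    show "inj_on ?T (Sigma ?A ?P)"
    proof (rule inj_onI)
      fix a b assume ab: "a \<in> Sigma ?A ?P" "b \<in> Sigma ?A ?P" "?T a = ?T b"
      obtain f z y where a_eq: "a = (f, (z, y))" by (metis prod.exhaust)
      obtain g z' y' where b_eq: "b = (g, (z', y'))" by (metis prod.exhaust)
      have fg: "f y = x" "g y' = x" using ab(1,2) by (simp_all add: a_eq b_eq children_def)
      have eq: "f(y := z) = g(y' := z')" "y = y'"
        using ab(3) unfolding a_eq b_eq split prod.inject by blast+
      have "f = (f(y := z))(y := x)" "g = (g(y' := z'))(y' := x)" using fg by auto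
      then have "f = g" using eq by metis
      moreover have "z = z'" using fun_cong[OF eq(1), of y] eq(2) by simp
      ultimately show "a = b" using eq(2) by (simp add: a_eq b_eq)
    qed
    show "?T ` Sigma ?A ?P \<subseteq> Sigma ?B ?Q"
    proof (rule image_subsetI)
      fix a assume a: "a \<in> Sigma ?A ?P"
      obtain f z y where a_eq: "a = (f, (z, y))" by (metis prod.exhaust)
      have f: "f \<in> parent_funs V r" and k: "Suc k \<le> card (children V r f x)"
        and z: "z \<in> V" "z \<noteq> x" and y: "y \<in> children V r f x" "\<not> descends V r f z y"
        using a by (simp_all add: a_eq)
      have yV: "y \<in> V" "y \<noteq> r" using y by (simp_all add: children_def)
      have "children V r (f(y := z)) x = children V r f x - {y}"
        using children_upd[OF yV] z by simp
      then have "k \<le> card (children V r (f(y := z)) x)"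
        using k y(1) by (simp add: card_Diff_singleton)
      then show "?T a \<in> Sigma ?B ?Q"
        using parent_funs_move_subtree[OF f yV z(1) y(2)] yV by (simp add: a_eq)
    qed
    show "(card V - 1) * k \<le> card (?P f)" if "f \<in> ?A" for f
    proof -
      have f: "f \<in> parent_funs V r" and k: "Suc k \<le> card (children V r f x)" using that by simp_all
      have "k \<le> card (?Y f z)" for z
      proof -
        have "card (children V r f x - ?Y f z) \<le> 1"
        proof (rule ccontr)
          assume "\<not> ?thesis"
          then obtain y y' where "y \<in> children V r f x - ?Y f z" "y' \<in> children V r f x - ?Y f z" "y \<noteq> y'"
            using card_le_Suc0_iff_eq[of "children V r f x - ?Y f z"] finite_children[OF fin] by auto
          then show False
            using descends_comparable[of V r f z y y'] siblings_not_descend[OF f] by blast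
        qed
        moreover have "card (children V r f x) = card (children V r f x - ?Y f z) + card (?Y f z)"
          using finite_children[OF fin, of r f x]
          by (subst card_Un_disjoint[symmetric]) (auto intro!: arg_cong[where f = card])
        ultimately show ?thesis using k by linarith
      qed
      then have "(\<Sum>z\<in>V - {x}. k) \<le> (\<Sum>z\<in>V - {x}. card (?Y f z))" by (intro sum_mono) auto
      also have "\<dots> = card (?P f)" using fin by (simp add: finite_children)
      finally show ?thesis using fin x by (simp add: card_Diff_singleton)
    qed
  qed (use fin r in \<open>auto simp: finite_parent_funs finite_children card_Diff_singleton\<close>)
qed

text \<open>The gains of successive switchings multiply to a factorial. For \<open>k\<close> of
  order n^(1/6) this survives the union bound over all vertices \<open>x\<close>.\<close>

lemma card_many_children:
  assumes fin: "finite V" and r: "r \<in> V" and x: "x \<in> V" and V2: "2 \<le> card V"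
  shows "card {f \<in> parent_funs V r. Suc k \<le> card (children V r f x)} * fact k \<le> card (parent_funs V r)"
proof (induction k)
  case 0
  show ?case using fin by (auto intro!: card_mono finite_parent_funs)
next
  case (Suc k)
  let ?N = "\<lambda>k. card {f \<in> parent_funs V r. k \<le> card (children V r f x)}"
  have "?N (Suc (Suc k)) * ((card V - 1) * Suc k) \<le> ?N (Suc k) * (card V - 1)"
    by (rule card_many_children_step[OF fin r x])
  then have "(card V - 1) * (?N (Suc (Suc k)) * Suc k) \<le> (card V - 1) * ?N (Suc k)"
    by (simp only: ac_simps)
  then have "?N (Suc (Suc k)) * Suc k \<le> ?N (Suc k)"
    using V2 by (simp only: mult_le_cancel1)
  then have "?N (Suc (Suc k)) * Suc k * fact k \<le> ?N (Suc k) * fact k" by (rule mult_le_mono1)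
  also have "\<dots> \<le> card (parent_funs V r)" by (rule Suc.IH)
  finally show ?case by (simp add: algebra_simps)
qed

section \<open>Matchings\<close>

text \<open>Induction of Halmos and Vaughan. If a proper nonempty \<open>S\<close> is tight, it is
  matched on its own and the rest avoids its neighbours. Otherwise every proper nonempty subset has
  a surplus, so one index may take any neighbour \<open>y\<close>.\<close>

lemma hall_marriage:
  assumes "finite I" and "\<And>i. i \<in> I \<Longrightarrow> finite (N i)"
    and "\<And>S. S \<subseteq> I \<Longrightarrow> card S \<le> card (\<Union>(N ` S))"
  shows "\<exists>g. inj_on g I \<and> (\<forall>i\<in>I. g i \<in> N i)"
  using assms
proof (induction I arbitrary: N rule: finite_psubset_induct)
  case (psubset I)
  have fin: "finite (\<Union>(N ` S))" if "S \<subseteq> I" for S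
    using that psubset.hyps psubset.prems(1) by (meson finite_UN finite_subset subsetD)
  show ?case
  proof (cases "\<exists>S. S \<noteq> {} \<and> S \<subset> I \<and> card (\<Union>(N ` S)) = card S")
    case True
    then obtain S where S: "S \<noteq> {}" "S \<subset> I" "card (\<Union>(N ` S)) = card S" by blast
    obtain g1 where g1: "inj_on g1 S" "\<forall>i\<in>S. g1 i \<in> N i"
      using psubset.IH[of S N] S(2) psubset.prems by (meson psubset_imp_subset subset_trans subsetD)
    define N' where "N' = (\<lambda>i. N i - \<Union>(N ` S))"
    have "\<exists>g. inj_on g (I - S) \<and> (\<forall>i\<in>I - S. g i \<in> N' i)"
    proof (rule psubset.IH)
      show "I - S \<subset> I" using S by blast
      show "finite (N' i)" if "i \<in> I - S" for i using that psubset.prems(1) by (simp add: N'_def)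
      fix T assume T: "T \<subseteq> I - S"
      have finS: "finite S" and finT: "finite T"
        using S T psubset.hyps by (meson finite_subset psubset_imp_subset Diff_subset)+
      have "card S + card T = card (S \<union> T)"
        using T finS finT by (subst card_Un_disjoint) auto
      also have "\<dots> \<le> card (\<Union>(N ` (S \<union> T)))"
        using psubset.prems(2) S T by (metis Diff_subset Un_least psubset_imp_subset subset_trans)
      also have "\<Union>(N ` (S \<union> T)) = \<Union>(N ` S) \<union> \<Union>(N' ` T)" by (auto simp: N'_def)
      also have "card \<dots> \<le> card (\<Union>(N ` S)) + card (\<Union>(N' ` T))" by (rule card_Un_le)
      finally show "card T \<le> card (\<Union>(N' ` T))" using S(3) by simp
    qed
    then obtain g2 where g2: "inj_on g2 (I - S)" "\<forall>i\<in>I - S. g2 i \<in> N' i" by blast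
    let ?g = "\<lambda>i. if i \<in> S then g1 i else g2 i"
    have "inj_on ?g I"
    proof (rule inj_onI)
      fix i j assume ij: "i \<in> I" "j \<in> I" "?g i = ?g j"
      have *: "g1 a \<noteq> g2 b" if "a \<in> S" "b \<in> I - S" for a b
        using g1(2) g2(2) that unfolding N'_def by fastforce
      show "i = j"
        using ij * g1(1) g2(1) by (auto split: if_splits dest: inj_onD) (metis)+
    qed
    moreover have "\<forall>i\<in>I. ?g i \<in> N i" using g1(2) g2(2) by (auto simp: N'_def)
    ultimately show ?thesis by blast
  next
    case False
    show ?thesis
    proof (cases "I = {}")
      case True then show ?thesis by simp
    next
      case ne: False
      then obtain i where i: "i \<in> I" by blast
      have "card {i} \<le> card (\<Union>(N ` {i}))" using psubset.prems(2)[of "{i}"] i by blast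
      then have "N i \<noteq> {}" by auto
      then obtain y where y: "y \<in> N i" by blast
      define N' where "N' = (\<lambda>j. N j - {y})"
      have "\<exists>g. inj_on g (I - {i}) \<and> (\<forall>j\<in>I - {i}. g j \<in> N' j)"
      proof (rule psubset.IH)
        show "I - {i} \<subset> I" using i by blast
        show "finite (N' j)" if "j \<in> I - {i}" for j using that psubset.prems(1) by (simp add: N'_def)
        fix T assume T: "T \<subseteq> I - {i}"
        show "card T \<le> card (\<Union>(N' ` T))"
        proof (cases "T = {}")
          case False
          have "T \<subset> I" using T i by blast
          then have "card T \<le> card (\<Union>(N ` T))" "card (\<Union>(N ` T)) \<noteq> card T"
            using psubset.prems(2)[of T] \<open>\<nexists>S. _\<close> False by blast+
          moreover have "\<Union>(N' ` T) = \<Union>(N ` T) - {y}" by (auto simp: N'_def)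
          moreover have "card (\<Union>(N ` T)) - 1 \<le> card (\<Union>(N ` T) - {y})"
            by (metis card_Diff1_le card_Diff_singleton_if diff_le_self order.refl)
          ultimately show ?thesis by simp
        qed simp
      qed
      then obtain g where g: "inj_on g (I - {i})" "\<forall>j\<in>I - {i}. g j \<in> N' j" by blast
      have "inj_on (g(i := y)) I"
        using g unfolding N'_def inj_on_def by (metis DiffD2 DiffI fun_upd_apply singletonD singletonI)
      moreover have "\<forall>j\<in>I. (g(i := y)) j \<in> N j" using g(2) y by (auto simp: N'_def)
      ultimately show ?thesis by blast
    qed
  qed
qed

text \<open>In Hall's condition a set \<open>S\<close> of size up to \<open>s\<close> is served by
  one degree. A larger \<open>S\<close> misses fewer than \<open>s\<close> vertices of
  \<open>B\<close>, and a missed vertex has its \<open>s\<close> neighbours outside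
  \<open>S\<close>, so \<open>A\<close> exceeds \<open>S\<close> by at least
  \<open>s\<close>.\<close>

lemma perfect_matching:
  assumes fin: "finite A" "finite B" and card_eq: "card A = card B"
    and dA: "\<And>a. a \<in> A \<Longrightarrow> s \<le> card {b\<in>B. R a b}"
    and dB: "\<And>b. b \<in> B \<Longrightarrow> s \<le> card {a\<in>A. R a b}"
    and joined: "\<And>S T. S \<subseteq> A \<Longrightarrow> T \<subseteq> B \<Longrightarrow> card S = s \<Longrightarrow> card T = s \<Longrightarrow> \<exists>a\<in>S. \<exists>b\<in>T. R a b"
  shows "\<exists>g. inj_on g A \<and> (\<forall>a\<in>A. g a \<in> B \<and> R a (g a))"
proof -
  have "\<exists>g. inj_on g A \<and> (\<forall>a\<in>A. g a \<in> {b\<in>B. R a b})"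
  proof (rule hall_marriage)
    fix S assume S: "S \<subseteq> A"
    let ?N = "\<Union>a\<in>S. {b\<in>B. R a b}"
    have finS: "finite S" "finite ?N" using S fin by (auto intro: finite_subset)
    show "card S \<le> card ?N"
    proof (cases "card S \<le> s")
      case True
      show ?thesis
      proof (cases "S = {}")
        case False
        then obtain a where a: "a \<in> S" by blast
        have "card S \<le> s" by (fact True)
        also have "s \<le> card {b\<in>B. R a b}" using dA a S by blast
        also have "\<dots> \<le> card ?N" using a finS by (intro card_mono) auto
        finally show ?thesis .
      qed simp
    next
      case False
      then obtain S' where S': "S' \<subseteq> S" "card S' = s" by (meson nat_le_linear obtain_subset_with_card_n)
      have lt: "card (B - ?N) < s"
      proof (rule ccontr)
        assume "\<not> ?thesis"
        then obtain T where T: "T \<subseteq> B - ?N" "card T = s" by (meson not_less obtain_subset_with_card_n)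
        then obtain a b where "a \<in> S'" "b \<in> T" "R a b" using joined[of S' T] S' S by blast
        then show False using T S' by blast
      qed
      have cB: "card (B - ?N) + card ?N = card B"
      proof -
        have "?N \<subseteq> B" by blast
        then show ?thesis using fin(2) finS(2) card_mono[of B ?N] by (simp add: card_Diff_subset)
      qed
      show ?thesis
      proof (cases "B \<subseteq> ?N")
        case True
        then show ?thesis using card_eq S fin finS by (metis card_mono order.trans)
      next
        case False
        then obtain b where b: "b \<in> B" "b \<notin> ?N" by blast
        have "s \<le> card {a\<in>A. R a b}" using dB b by blast
        also have "\<dots> \<le> card (A - S)" using b fin by (intro card_mono) auto
        also have "\<dots> = card A - card S" using S finS by (simp add: card_Diff_subset)
        finally show ?thesis using lt cB card_eq by linarith
      qed
    qed
  qed (use fin in auto)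
  then show ?thesis by blast
qed

section \<open>Embedding a tree with many twigs\<close>

text \<open>The exact size \<open>s\<close> suits the union bound; \<open>joinedD\<close> passes to
  larger sets.\<close>

definition joined :: "'a set \<Rightarrow> 'a set set \<Rightarrow> nat \<Rightarrow> bool" where
  "joined V E s \<longleftrightarrow> (\<forall>A B. A \<subseteq> V \<longrightarrow> B \<subseteq> V \<longrightarrow> A \<inter> B = {} \<longrightarrow> card A = s \<longrightarrow> card B = s \<longrightarrow>
     (\<exists>a\<in>A. \<exists>b\<in>B. {a, b} \<in> E))"

lemma joinedD:
  assumes "joined V E s" "A \<subseteq> V" "B \<subseteq> V" "A \<inter> B = {}" "s \<le> card A" "s \<le> card B"
  shows "\<exists>a\<in>A. \<exists>b\<in>B. {a, b} \<in> E"
proof -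
  obtain A' B' where "A' \<subseteq> A" "card A' = s" "B' \<subseteq> B" "card B' = s"
    using assms(5,6) by (meson obtain_subset_with_card_n)
  moreover from this have "A' \<subseteq> V" "B' \<subseteq> V" "A' \<inter> B' = {}" using assms(2-4) by blast+
  ultimately have "\<exists>a\<in>A'. \<exists>b\<in>B'. {a, b} \<in> E" using assms(1) unfolding joined_def by blast
  then show ?thesis using \<open>A' \<subseteq> A\<close> \<open>B' \<subseteq> B\<close> by blast
qed
text \<open>Joinedness limits the number of blocked parents. The bound on children turns this into a
  limit on the vertices that had to be placed elsewhere because of them.\<close>

lemma card_vertices_with_few_parents:
  assumes fin: "finite W" and deg: "\<And>v. v \<in> W \<Longrightarrow> card (children W r f v) \<le> \<Delta>"
    and C: "C \<subseteq> W - {r}" and fC: "f ` C \<subseteq> W" and few: "card (f ` C) \<le> k"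
  shows "card C \<le> \<Delta> * k"
proof -
  have "C \<subseteq> (\<Union>q\<in>f ` C. children W r f q)" using C by (auto simp: children_def)
  moreover have finC: "finite C" using C fin by (meson finite_Diff finite_subset)
  moreover have "finite (children W r f q)" for q using fin by (simp add: children_def)
  ultimately have "card C \<le> card (\<Union>q\<in>f ` C. children W r f q)"
    by (intro card_mono) auto
  also have "\<dots> \<le> (\<Sum>q\<in>f ` C. card (children W r f q))" by (rule card_UN_le) (simp add: finC)
  also have "\<dots> \<le> (\<Sum>q\<in>f ` C. \<Delta>)" using deg fC by (intro sum_mono) auto
  also have "\<dots> \<le> \<Delta> * k" using few by simp
  finally show ?thesis .
qed

text \<open>The last four conclusions record the greedy preferences (\<open>X\<close> for vertices of \<open>P\<close>, then \<open>M\<close>, then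
  \<open>Z\<close>). They persist because the free parts of \<open>M\<close> and \<open>X\<close> only shrink, and the clause about \<open>Z\<close>
  is the induction hypothesis that keeps \<open>Z\<close> from filling up.\<close>

lemma greedy_embedding:
  fixes V :: "'a set" and W :: "'b set"
  assumes finV: "finite V" and finW: "finite W"
    and f: "f \<in> parent_funs W r"
    and joined: "joined V E s"
    and deg: "\<And>v. v \<in> W \<Longrightarrow> card (children W r f v) \<le> \<Delta>"
    and parts: "X \<subseteq> V" "Z \<subseteq> V" "M \<subseteq> V" "X \<inter> Z = {}" "X \<inter> M = {}" "Z \<inter> M = {}"
    and Zdeg: "\<And>v. v \<in> V \<Longrightarrow> card {z\<in>Z. {v, z} \<in> E} > \<Delta> * s"
    and S: "S \<subseteq> W" "r \<in> S" "\<And>x. x \<in> S \<Longrightarrow> x \<noteq> r \<Longrightarrow> f x \<in> S"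
    and room: "card S + s \<le> card M"
    and P: "r \<notin> P"
  shows "\<exists>\<phi>. inj_on \<phi> S \<and> \<phi> ` S \<subseteq> X \<union> Z \<union> M \<and> (\<forall>x\<in>S - {r}. {\<phi> x, \<phi> (f x)} \<in> E)
     \<and> \<phi> r \<in> M
     \<and> (\<forall>u\<in>S - {r}. \<phi> u \<in> Z \<longrightarrow> (\<forall>w\<in>M - \<phi> ` S. {\<phi> (f u), w} \<notin> E))
     \<and> (\<forall>u\<in>S \<inter> P. \<phi> u \<notin> X \<longrightarrow> (\<forall>w\<in>X - \<phi> ` S. {\<phi> (f u), w} \<notin> E))
     \<and> (\<forall>u\<in>S - P. \<phi> u \<notin> X)"
  using S room
proof (induction "card S" arbitrary: S rule: less_induct)
  case less
  obtain h :: "'b \<Rightarrow> nat" where h: "\<forall>x\<in>W - {r}. h (f x) < h x"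
    using f unfolding parent_funs_def by blast
  have finS: "finite S" using less.prems(1) finW finite_subset by blast
  have finM: "finite M" and finX: "finite X" and finZ: "finite Z" using parts finV finite_subset by blast+
  show ?case
  proof (cases "S = {r}")
    case True
    then have "M \<noteq> {}" using less.prems(4) by auto
    then obtain m where m: "m \<in> M" by blast
    show ?thesis
      by (rule exI[of _ "\<lambda>_. m"]) (use True m P parts in auto)
  next
    case False
    then have ne: "S - {r} \<noteq> {}" using less.prems(2) by blast
    \<comment> \<open>A non-root vertex of highest rank is nobody's parent in \<open>S\<close>, so
      removing it keeps \<open>S\<close> closed under parents and it can be embedded last.\<close>
    have "Max (h ` (S - {r})) \<in> h ` (S - {r})" using finS ne by (intro Max_in) auto
    then obtain u where u: "u \<in> S - {r}" and umax': "h u = Max (h ` (S - {r}))"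
      by (metis (no_types, lifting) imageE)
    have umax: "h x \<le> h u" if "x \<in> S - {r}" for x
      unfolding umax' using that finS by (intro Max_ge) auto
    define S' where "S' = S - {u}"
    have u_notin: "f x \<noteq> u" if "x \<in> S" "x \<noteq> r" for x
      using umax[of x] h that less.prems(1) by (metis Diff_iff empty_iff insert_iff leD subsetD)
    have S': "S' \<subseteq> W" "r \<in> S'" "\<And>x. x \<in> S' \<Longrightarrow> x \<noteq> r \<Longrightarrow> f x \<in> S'"
      using less.prems u u_notin unfolding S'_def by auto
    have card_S': "card S' < card S" using card_Diff1_less[of S u] finS u unfolding S'_def by blast
    have "card S' + s \<le> card M" using card_S' less.prems(4) by linarith
    then obtain \<phi> where inj: "inj_on \<phi> S'" and img: "\<phi> ` S' \<subseteq> X \<union> Z \<union> M"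
      and edge: "\<forall>x\<in>S' - {r}. {\<phi> x, \<phi> (f x)} \<in> E" and root: "\<phi> r \<in> M"
      and I1: "\<forall>u\<in>S' - {r}. \<phi> u \<in> Z \<longrightarrow> (\<forall>w\<in>M - \<phi> ` S'. {\<phi> (f u), w} \<notin> E)"
      and I2: "\<forall>u\<in>S' \<inter> P. \<phi> u \<notin> X \<longrightarrow> (\<forall>w\<in>X - \<phi> ` S'. {\<phi> (f u), w} \<notin> E)"
      and I3: "\<forall>u\<in>S' - P. \<phi> u \<notin> X"
      using less.hyps[OF card_S' S'(1-3)] by blast
    have fu: "f u \<in> S'" using less.prems(3) u u_notin unfolding S'_def by blast
    define w where "w = \<phi> (f u)"
    have wV: "w \<in> V" using fu img parts unfolding w_def by blast
    have finS': "finite S'" using finS by (simp add: S'_def)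
    define U where "U = M - \<phi> ` S'"
    have cardU: "s \<le> card U"
    proof -
      have "card M - card (\<phi> ` S') \<le> card U" unfolding U_def by (rule diff_card_le_card_Diff) (simp add: finS')
      moreover have "card (\<phi> ` S') \<le> card S'" using finS' by (rule card_image_le)
      ultimately show ?thesis using less.prems(4) card_S' by linarith
    qed
    have "\<exists>v. v \<in> X \<union> Z \<union> M - \<phi> ` S' \<and> {w, v} \<in> E \<and> (v \<in> Z \<longrightarrow> (\<forall>y\<in>M - \<phi> ` S'. {w, y} \<notin> E))
        \<and> (u \<in> P \<longrightarrow> v \<notin> X \<longrightarrow> (\<forall>y\<in>X - \<phi> ` S'. {w, y} \<notin> E)) \<and> (u \<notin> P \<longrightarrow> v \<notin> X)"
    proof (cases "u \<in> P \<and> (\<exists>x\<in>X - \<phi> ` S'. {w, x} \<in> E)")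
      case True
      then show ?thesis using parts by blast
    next
      case noX: False
      show ?thesis
      proof (cases "\<exists>m\<in>U. {w, m} \<in> E")
        case True
        then show ?thesis using noX parts unfolding U_def by blast
      next
        case False
        define Zs where "Zs = {x \<in> S' - {r}. \<phi> x \<in> Z}"
        have finZs: "finite Zs" using finS' by (simp add: Zs_def)
        have fZs: "f ` Zs \<subseteq> S'" using S'(3) by (auto simp: Zs_def)
        \<comment> \<open>By the invariant for \<open>Z\<close>, the images of these parents have no
          neighbour in \<open>U\<close>, which has size at least \<open>s\<close>.\<close>
        have "card (\<phi> ` f ` Zs) < s"
        proof (rule ccontr)
          assume "\<not> ?thesis"
          then have "\<exists>a\<in>\<phi> ` f ` Zs. \<exists>b\<in>U. {a, b} \<in> E"
          proof (intro joinedD[OF joined])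
            show "\<phi> ` f ` Zs \<subseteq> V" using fZs img parts by blast
            show "\<phi> ` f ` Zs \<inter> U = {}" using fZs unfolding U_def by blast
          qed (use cardU parts U_def in auto)
          then show False using I1 unfolding U_def Zs_def by blast
        qed
        moreover have "card (\<phi> ` f ` Zs) = card (f ` Zs)"
          using inj fZs by (meson card_image inj_on_subset)
        ultimately have "card Zs \<le> \<Delta> * s"
          using fZs S'(1) by (intro card_vertices_with_few_parents[OF finW deg]) (auto simp: Zs_def)
        \<comment> \<open>The root was sent to \<open>M\<close>, so every used vertex of
          \<open>Z\<close> is the image of a vertex in \<open>Zs\<close>.\<close>
        moreover have "\<phi> ` S' \<inter> Z \<subseteq> \<phi> ` Zs" using root parts unfolding Zs_def by blast
        then have "card (\<phi> ` S' \<inter> Z) \<le> card Zs"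
          using finZs by (meson card_image_le card_mono finite_imageI le_trans)
        ultimately have "card (\<phi> ` S' \<inter> Z) < card {z\<in>Z. {w, z} \<in> E}" using Zdeg[OF wV] by linarith
        then have "\<not> {z\<in>Z. {w, z} \<in> E} \<subseteq> \<phi> ` S' \<inter> Z"
          using finZ by (meson card_mono finite_Int leD)
        then obtain z where "z \<in> Z" "{w, z} \<in> E" "z \<notin> \<phi> ` S'" by blast
        then show ?thesis using False noX parts unfolding U_def by blast
      qed
    qed
    then obtain v where v: "v \<in> X \<union> Z \<union> M" "v \<notin> \<phi> ` S'" "{w, v} \<in> E"
      and v1: "v \<in> Z \<longrightarrow> (\<forall>y\<in>M - \<phi> ` S'. {w, y} \<notin> E)"
      and v2: "u \<in> P \<longrightarrow> v \<notin> X \<longrightarrow> (\<forall>y\<in>X - \<phi> ` S'. {w, y} \<notin> E)" and v3: "u \<notin> P \<longrightarrow> v \<notin> X"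
      by blast
    define \<psi> where "\<psi> = \<phi>(u := v)"
    have eq: "\<psi> x = \<phi> x" if "x \<in> S'" for x using that by (auto simp: \<psi>_def S'_def)
    have \<psi>u: "\<psi> u = v" by (simp add: \<psi>_def)
    have Sins: "S = insert u S'" "u \<notin> S'" "u \<noteq> r" using u by (auto simp: S'_def)
    have im: "\<psi> ` S = insert v (\<phi> ` S')" using eq \<psi>u Sins by auto
    have par: "\<psi> (f x) = \<phi> (f x)" if "x \<in> S" "x \<noteq> r" for x
    proof -
      have "f x \<in> S'" using that S'(3) fu Sins by auto
      then show ?thesis by (rule eq)
    qed
    have "inj_on \<psi> S'" using inj inj_on_cong[of S' \<psi> \<phi>] eq by blast
    moreover have "\<psi> ` S' = \<phi> ` S'" using eq by (rule image_cong[OF refl])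
    ultimately have "inj_on \<psi> S"
      unfolding Sins(1) inj_on_insert \<psi>u using v(2) Sins(2) by simp
    moreover have "\<psi> ` S \<subseteq> X \<union> Z \<union> M" unfolding im using img v(1) by simp
    moreover have cases_S: "x = u \<or> x \<in> S'" if "x \<in> S" for x using that Sins(1) by blast
    have "\<forall>x\<in>S - {r}. {\<psi> x, \<psi> (f x)} \<in> E"
    proof
      fix x assume x: "x \<in> S - {r}"
      then have "\<psi> (f x) = \<phi> (f x)" using par by blast
      moreover have "{\<phi> (f u), v} \<in> E" using v(3) unfolding w_def .
      ultimately show "{\<psi> x, \<psi> (f x)} \<in> E"
        using cases_S[of x] x edge eq[of x] \<psi>u by (cases "x = u") (auto simp: insert_commute)
    qed
    moreover have "\<psi> r \<in> M" using eq S'(2) root by simp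
    moreover have "\<forall>x\<in>S - {r}. \<psi> x \<in> Z \<longrightarrow> (\<forall>y\<in>M - \<psi> ` S. {\<psi> (f x), y} \<notin> E)"
    proof (intro ballI impI)
      fix x y assume x: "x \<in> S - {r}" "\<psi> x \<in> Z" and y: "y \<in> M - \<psi> ` S"
      have "y \<in> M - \<phi> ` S'" using y unfolding im by simp
      moreover have "\<psi> (f x) = \<phi> (f x)" using par x by blast
      ultimately show "{\<psi> (f x), y} \<notin> E"
        using cases_S[of x] x I1 v1 eq[of x] \<psi>u unfolding w_def by (cases "x = u") auto
    qed
    moreover have "\<forall>x\<in>S \<inter> P. \<psi> x \<notin> X \<longrightarrow> (\<forall>y\<in>X - \<psi> ` S. {\<psi> (f x), y} \<notin> E)"
    proof (intro ballI impI)
      fix x y assume x: "x \<in> S \<inter> P" "\<psi> x \<notin> X" and y: "y \<in> X - \<psi> ` S"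
      have "y \<in> X - \<phi> ` S'" using y unfolding im by simp
      moreover have "x \<noteq> r" using x P by blast
      then have "\<psi> (f x) = \<phi> (f x)" using par x by blast
      ultimately show "{\<psi> (f x), y} \<notin> E"
        using cases_S[of x] x I2 v2 eq[of x] \<psi>u unfolding w_def by (cases "x = u") auto
    qed
    moreover have "\<forall>x\<in>S - P. \<psi> x \<notin> X" using I3 v3 eq \<psi>u cases_S by (metis DiffD1 DiffD2 DiffI)
    ultimately show ?thesis by blast
  qed
qed

text \<open>\<open>twigs1\<close> leaves \<open>s\<close> spare vertices outside the reserved sets
  for the tree without the twig leaves. By \<open>twigs2\<close> the twigs would overfill
  \<open>X\<close> if at most \<Delta> s of them were placed elsewhere; so fewer than
  \<open>s\<close> vertices of \<open>X\<close> stay uncovered, and of \<open>2 * s\<close>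
  neighbours in \<open>X\<close> at least \<open>s\<close> are covered.\<close>

lemma contains_copy_parent_tree:
  fixes V :: "'a set" and W :: "'b set"
  assumes finV: "finite V" and finW: "finite W" and r: "r \<in> W" and cardVW: "card V = card W"
    and f: "f \<in> parent_funs W r"
    and joined: "joined V E s"
    and deg: "\<And>v. v \<in> W \<Longrightarrow> card (children W r f v) \<le> \<Delta>"
    and disj: "X \<inter> Y = {}" "X \<inter> Z = {}" "Y \<inter> Z = {}" and sub: "X \<subseteq> V" "Y \<subseteq> V" "Z \<subseteq> V"
    and Xdeg: "\<And>v. v \<in> V \<Longrightarrow> card {x\<in>X. {v, x} \<in> E} \<ge> 2 * s"
    and Ydeg: "\<And>v. v \<in> V \<Longrightarrow> card {y\<in>Y. {v, y} \<in> E} \<ge> s"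
    and Zdeg: "\<And>v. v \<in> V \<Longrightarrow> card {z\<in>Z. {v, z} \<in> E} > \<Delta> * s"
    and twigs1: "card (twigs W r f) \<ge> card X + card Y + card Z + s"
    and twigs2: "card (twigs W r f) > card X + \<Delta> * s"
  shows "contains_copy (V, E) (parent_tree W r f)"
proof -
  define M where "M = V - X - Y - Z"
  define P where "P = twigs W r f"
  define L where "L = {l \<in> W. children W r f l = {} \<and> f l \<in> P \<and> l \<noteq> r}"
  define S where "S = W - L"
  have P_sub: "P \<subseteq> W - {r}" by (auto simp: P_def twigs_def)
  have fin: "finite P" "finite L" "finite S" "finite X" "finite Y" "finite Z" "finite M"
    using finW finV P_sub sub unfolding L_def S_def M_def by (auto intro: finite_subset)
  have PL: "P \<inter> L = {}" by (auto simp: P_def twigs_def L_def)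
  have twig_leaf: "\<exists>l. children W r f p = {l}" "children W r f p \<subseteq> L" if "p \<in> P" for p
    using that by (auto simp: P_def twigs_def L_def children_def)
  have L_child: "children W r f (f l) = {l}" if "l \<in> L" for l
  proof -
    have l: "l \<in> children W r f (f l)" using that unfolding L_def children_def by blast
    have "f l \<in> P" using that unfolding L_def by blast
    from twig_leaf(1)[OF this] obtain l' where l': "children W r f (f l) = {l'}" ..
    have "l = l'" using l unfolding l' by (rule singletonD)
    then show ?thesis using l' by blast
  qed
  \<comment> \<open>One vertex per twig remains to be placed, so a matching of twigs
    suffices.\<close>
  have bij: "bij_betw f L P"
  proof (rule bij_betwI')
    show "(f x = f y) = (x = y)" if "x \<in> L" "y \<in> L" for x y
      using L_child that by (metis singleton_inject)
    show "f x \<in> P" if "x \<in> L" for x using that by (simp add: L_def)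
    show "\<exists>x\<in>L. p = f x" if p: "p \<in> P" for p
    proof -
      obtain l where "children W r f p = {l}" using twig_leaf(1)[OF p] by blast
      then have "l \<in> children W r f p" by simp
      moreover from this have "p = f l" by (simp add: children_def)
      ultimately show ?thesis using twig_leaf(2)[OF p] by blast
    qed
  qed
  have cardL: "card L = card P" using bij by (rule bij_betw_same_card)
  have L_sub: "L \<subseteq> W" by (auto simp: L_def)
  have cardS: "card S = card W - card P"
    using cardL L_sub fin by (simp add: S_def card_Diff_subset)
  have PleW: "card P \<le> card W" using L_sub finW cardL by (metis card_mono)
  have S: "S \<subseteq> W" "r \<in> S" "\<And>x. x \<in> S \<Longrightarrow> x \<noteq> r \<Longrightarrow> f x \<in> S"
    using r parent_funs_in[OF f] by (auto simp: S_def L_def children_def)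
  have room: "card S + s \<le> card M"
  proof -
    have "card M \<ge> card V - card X - card Y - card Z"
      unfolding M_def by (meson diff_card_le_card_Diff diff_le_mono fin le_trans)
    then show ?thesis using twigs1 cardS PleW cardVW unfolding P_def by linarith
  qed
  have M: "M \<subseteq> V" "X \<inter> M = {}" "Z \<inter> M = {}" and rP: "r \<notin> P"
    using P_sub by (auto simp: M_def)
  have "\<exists>\<phi>. inj_on \<phi> S \<and> \<phi> ` S \<subseteq> X \<union> Z \<union> M \<and> (\<forall>x\<in>S - {r}. {\<phi> x, \<phi> (f x)} \<in> E)
     \<and> \<phi> r \<in> M
     \<and> (\<forall>u\<in>S - {r}. \<phi> u \<in> Z \<longrightarrow> (\<forall>w\<in>M - \<phi> ` S. {\<phi> (f u), w} \<notin> E))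
     \<and> (\<forall>u\<in>S \<inter> P. \<phi> u \<notin> X \<longrightarrow> (\<forall>w\<in>X - \<phi> ` S. {\<phi> (f u), w} \<notin> E))
     \<and> (\<forall>u\<in>S - P. \<phi> u \<notin> X)"
    by (rule greedy_embedding[OF finV finW f joined deg sub(1,3) M(1) disj(2) M(2,3) Zdeg S room rP])
  then  obtain \<phi> where inj: "inj_on \<phi> S" and img: "\<phi> ` S \<subseteq> X \<union> Z \<union> M"
      and edge: "\<forall>x\<in>S - {r}. {\<phi> x, \<phi> (f x)} \<in> E"
      and I2: "\<forall>u\<in>S \<inter> P. \<phi> u \<notin> X \<longrightarrow> (\<forall>w\<in>X - \<phi> ` S. {\<phi> (f u), w} \<notin> E)"
      and I3: "\<forall>u\<in>S - P. \<phi> u \<notin> X"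
    by (elim exE conjE) (rule that; assumption)
  have PS: "P \<subseteq> S" using P_sub PL by (auto simp: S_def)
  have imgV: "\<phi> ` S \<subseteq> V" "\<phi> ` S \<inter> Y = {}" using img sub disj by (auto simp: M_def)
  have uncovered: "card (X - \<phi> ` S) < s"
  proof (rule ccontr)
    assume big: "\<not> ?thesis"
    \<comment> \<open>The twigs that evaded \<open>X\<close>. If \<open>s\<close> vertices of
      \<open>X\<close> were still free, the parents of these twigs would have no neighbour among
      them.\<close>
    define P' where "P' = {p\<in>P. \<phi> p \<notin> X}"
    have fP': "f ` P' \<subseteq> S" using PS P_sub S(3) by (auto simp: P'_def)
    have finP': "finite P'" using fin by (simp add: P'_def)
    have "card (\<phi> ` f ` P') < s"
    proof (rule ccontr)
      assume "\<not> ?thesis"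
      then have "\<exists>a\<in>\<phi> ` f ` P'. \<exists>b\<in>X - \<phi> ` S. {a, b} \<in> E"
        using big fP' imgV sub by (intro joinedD[OF joined]) auto
      then show False using I2 PS unfolding P'_def by blast
    qed
    moreover have "card (\<phi> ` f ` P') = card (f ` P')"
      using inj fP' by (meson card_image inj_on_subset)
    ultimately have "card P' \<le> \<Delta> * s"
      using fP' S(1) P_sub by (intro card_vertices_with_few_parents[OF finW deg]) (auto simp: P'_def)
    moreover have "card (P - P') \<le> card X"
    proof (rule card_inj_on_le)
      show "inj_on \<phi> (P - P')" using inj PS by (meson Diff_subset inj_on_subset)
    qed (use fin in \<open>auto simp: P'_def\<close>)
    moreover have "card P \<le> card (P - P') + card P'"
      using diff_card_le_card_Diff[OF finP', of P] by linarith
    ultimately show False using twigs2 unfolding P_def by linarith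
  qed
  define B where "B = V - \<phi> ` S"
  have "\<exists>g. inj_on g P \<and> (\<forall>p\<in>P. g p \<in> B \<and> {\<phi> p, g p} \<in> E)"
  proof (rule perfect_matching)
    show "finite P" "finite B" using fin finV by (auto simp: B_def)
    have "card (\<phi> ` S) = card S" using inj by (rule card_image)
    then show "card P = card B"
      using imgV fin cardS PleW cardVW by (simp add: B_def card_Diff_subset)
    show "s \<le> card {b \<in> B. {\<phi> p, b} \<in> E}" if "p \<in> P" for p
    proof -
      have "s \<le> card {y\<in>Y. {\<phi> p, y} \<in> E}" using Ydeg[of "\<phi> p"] imgV PS that by blast
      also have "\<dots> \<le> card {b \<in> B. {\<phi> p, b} \<in> E}"
        using imgV sub finV by (intro card_mono) (auto simp: B_def)
      finally show ?thesis .
    qed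
    show "s \<le> card {p \<in> P. {\<phi> p, b} \<in> E}" if "b \<in> B" for b
    proof -
      let ?X = "{x\<in>X. {b, x} \<in> E}"
      have "2 * s \<le> card ?X" using that Xdeg by (simp add: B_def)
      moreover have "card (?X - \<phi> ` S) \<le> card (X - \<phi> ` S)" using fin by (intro card_mono) auto
      moreover have "card ?X = card (?X \<inter> \<phi> ` S) + card (?X - \<phi> ` S)"
        using fin by (intro card_Int_Diff) simp
      ultimately have "s \<le> card (?X \<inter> \<phi> ` S)" using uncovered by linarith
      \<comment> \<open>Only twigs are ever sent to \<open>X\<close>, so covered neighbours in
        \<open>X\<close> are images of twigs.\<close>
      also have "?X \<inter> \<phi> ` S \<subseteq> \<phi> ` {p \<in> P. {\<phi> p, b} \<in> E}"
        using I3 by (auto simp: insert_commute)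
      then have "card (?X \<inter> \<phi> ` S) \<le> card {p \<in> P. {\<phi> p, b} \<in> E}"
        using fin by (intro surj_card_le) auto
      finally show ?thesis .
    qed
    show "\<exists>a\<in>A. \<exists>b\<in>C. {\<phi> a, b} \<in> E" if "A \<subseteq> P" "C \<subseteq> B" "card A = s" "card C = s" for A C
    proof -
      have "A \<subseteq> S" using that PS by blast
      then have "card (\<phi> ` A) = s" using inj that by (simp add: card_image inj_on_subset)
      moreover have "\<phi> ` A \<subseteq> V" "\<phi> ` A \<inter> C = {}" "C \<subseteq> V"
        using \<open>A \<subseteq> S\<close> imgV that unfolding B_def by blast+
      ultimately have "\<exists>a\<in>\<phi> ` A. \<exists>b\<in>C. {a, b} \<in> E"
        using that by (intro joinedD[OF joined]) simp_all
      then show ?thesis by blast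
    qed
  qed
  then obtain g where g: "inj_on g P" "\<And>p. p \<in> P \<Longrightarrow> g p \<in> B" "\<And>p. p \<in> P \<Longrightarrow> {\<phi> p, g p} \<in> E"
    by blast
  define \<psi> where "\<psi> = (\<lambda>x. if x \<in> L then g (f x) else \<phi> x)"
  have fL: "f l \<in> P" "f l \<notin> L" if "l \<in> L" for l using that PL by (auto simp: L_def)
  have "inj_on \<psi> W"
  proof (rule inj_onI)
    fix x y assume xy: "x \<in> W" "y \<in> W" "\<psi> x = \<psi> y"
    have ne: "g (f l) \<noteq> \<phi> u" if "l \<in> L" "u \<in> S" for l u
      using g(2) fL(1)[OF that(1)] that(2) by (auto simp: B_def)
    have "inj_on (g \<circ> f) L" using g(1) bij by (simp add: bij_betw_def comp_inj_on)
    then show "x = y" using xy ne inj by (auto simp: \<psi>_def S_def inj_on_def split: if_splits) metis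
  qed
  moreover have "\<psi> ` W \<subseteq> V" using g(2) fL imgV by (auto simp: \<psi>_def B_def S_def)
  moreover have "{\<psi> x, \<psi> (f x)} \<in> E" if "x \<in> W - {r}" for x
  proof (cases "x \<in> L")
    case True
    then show ?thesis using g(3)[of "f x"] fL[of x] by (simp add: \<psi>_def insert_commute)
  next
    case False
    then have "x \<in> S" "f x \<in> S" using that S(3) by (auto simp: S_def)
    then show ?thesis using edge that by (auto simp: \<psi>_def S_def)
  qed
  ultimately show ?thesis unfolding contains_copy_def parent_tree_def by auto
qed

section \<open>The random graph\<close>

definition block :: "nat \<Rightarrow> nat \<Rightarrow> nat set" where
  "block s j = {j * s<..Suc j * s}"

text \<open>Fixed blocks leave at most n^2 events to the union bound. One neighbour per block
  replaces a concentration bound for the degrees into the reserved sets.\<close>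

definition block_joined :: "nat \<Rightarrow> nat set set \<Rightarrow> nat \<Rightarrow> bool" where
  "block_joined n E s \<longleftrightarrow>
     (\<forall>v\<in>{1..n}. \<forall>j. Suc j * s \<le> n \<longrightarrow> v \<notin> block s j \<longrightarrow> (\<exists>b\<in>block s j. {v, b} \<in> E))"

text \<open>Disjoint blocks give distinct neighbours. The block that contains \<open>v\<close> may
  give none, which is the loss of 1.\<close>

lemma card_neighbours_in_blocks:
  assumes bj: "block_joined n E s" and s: "0 < s" and b: "b * s \<le> n" and v: "v \<in> {1..n}"
  shows "b - a - 1 \<le> card {z\<in>{a * s<..b * s}. {v, z} \<in> E}"
proof -
  have block_idx: "(z - 1) div s = j" if "z \<in> block s j" for z j
  proof -
    have "z - 1 = (z - 1 - j * s) + j * s" "z - 1 - j * s < s" using that by (auto simp: block_def)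
    then have "(z - 1) div s = ((z - 1 - j * s) + j * s) div s" by simp
    also have "\<dots> = j + (z - 1 - j * s) div s" using s by (intro div_mult_self1) simp
    also have "\<dots> = j" using \<open>z - 1 - j * s < s\<close> by simp
    finally show ?thesis .
  qed
  define J where "J = {j. a \<le> j \<and> j < b \<and> v \<notin> block s j}"
  have "\<exists>z. z \<in> block s j \<and> {v, z} \<in> E" if "j \<in> J" for j
  proof -
    have "Suc j * s \<le> b * s" using that by (intro mult_le_mono1) (simp add: J_def)
    then have "Suc j * s \<le> n" using b by (rule order.trans)
    moreover have "v \<notin> block s j" using that by (simp add: J_def)
    ultimately show ?thesis using bj v unfolding block_joined_def by blast
  qed
  then obtain g where g: "\<And>j. j \<in> J \<Longrightarrow> g j \<in> block s j" "\<And>j. j \<in> J \<Longrightarrow> {v, g j} \<in> E" by metis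
  have "inj_on g J"
    using g(1) block_idx by (metis inj_onI)
  moreover have "g ` J \<subseteq> {z\<in>{a * s<..b * s}. {v, z} \<in> E}"
  proof
    fix z assume "z \<in> g ` J"
    then obtain j where j: "j \<in> J" "z = g j" by blast
    have "a \<le> j" "Suc j \<le> b" using j by (auto simp: J_def)
    then have "a * s \<le> j * s" "Suc j * s \<le> b * s" by (simp_all only: mult_le_mono1)
    moreover have "j * s < z" "z \<le> Suc j * s" using g(1)[OF j(1)] j(2) by (simp_all add: block_def)
    ultimately have "a * s < z" "z \<le> b * s" by linarith+
    then show "z \<in> {z\<in>{a * s<..b * s}. {v, z} \<in> E}" using g(2)[OF j(1)] j(2) by simp
  qed
  ultimately have "card J \<le> card {z\<in>{a * s<..b * s}. {v, z} \<in> E}"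
    by (intro card_inj_on_le[of g]) auto
  moreover have "{a..<b} - {(v - 1) div s} \<subseteq> J"
    using block_idx[of v] by (auto simp: J_def)
  then have "card ({a..<b} - {(v - 1) div s}) \<le> card J" by (intro card_mono) (auto simp: J_def)
  moreover have "card {a..<b} - 1 \<le> card ({a..<b} - {(v - 1) div s})"
    using diff_card_le_card_Diff[of "{(v - 1) div s}" "{a..<b}"] by simp
  ultimately show ?thesis by simp
qed

section \<open>Union bounds for the random graph\<close>

lemma finite_all_pairs: "finite V \<Longrightarrow> finite (all_pairs V)"
  by (simp add: all_pairs_def)

lemma prob_avoids_edges:
  assumes p: "0 \<le> p" "p \<le> 1" and F: "F \<subseteq> all_pairs {1..n}"
  shows "measure_pmf.prob (random_graph n p) {G. snd G \<inter> F = {}} = (1 - p) ^ card F"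
proof -
  let ?A = "all_pairs {1..n}"
  let ?B = "\<lambda>e. if e \<in> F then {False} else UNIV"
  have fin: "finite ?A" by (simp add: finite_all_pairs)
  have "(\<lambda>X. ({1..n}, {e \<in> ?A. X e})) -` {G. snd G \<inter> F = {}} = Pi ?A ?B"
    using F by (auto simp: Pi_def)
  then have "measure_pmf.prob (random_graph n p) {G. snd G \<inter> F = {}}
      = (\<Prod>e\<in>?A. measure_pmf.prob (bernoulli_pmf p) (?B e))"
    unfolding random_graph_def measure_map_pmf by (simp only: measure_Pi_pmf_Pi[OF fin])
  also have "\<dots> = (\<Prod>e\<in>?A. if e \<in> F then 1 - p else 1)"
    using p by (intro prod.cong) (auto simp: measure_pmf_single)
  also have "\<dots> = (\<Prod>e\<in>F. 1 - p)"
    using fin F by (intro prod.mono_neutral_cong_right) auto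
  finally show ?thesis by simp
qed

lemma prob_no_cross_edge:
  assumes p: "0 \<le> p" "p \<le> 1" and AB: "A \<subseteq> {1..n}" "B \<subseteq> {1..n}" "A \<inter> B = {}"
  shows "measure_pmf.prob (random_graph n p) {G. \<not> (\<exists>a\<in>A. \<exists>b\<in>B. {a, b} \<in> snd G)}
    \<le> exp (- p * card A * card B)"
proof -
  let ?F = "(\<lambda>(a, b). {a, b}) ` (A \<times> B)"
  have "inj_on (\<lambda>(a, b). {a, b}) (A \<times> B)"
    using AB(3) by (auto simp: inj_on_def doubleton_eq_iff)
  then have cardF: "card ?F = card A * card B"
    by (simp add: card_image card_cartesian_product)
  have F: "?F \<subseteq> all_pairs {1..n}"
    using AB by (auto simp: all_pairs_def card_2_iff) blast
  have "{G :: nat graph. \<not> (\<exists>a\<in>A. \<exists>b\<in>B. {a, b} \<in> snd G)} = {G. snd G \<inter> ?F = {}}" by auto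
  then have "measure_pmf.prob (random_graph n p) {G. \<not> (\<exists>a\<in>A. \<exists>b\<in>B. {a, b} \<in> snd G)}
      = (1 - p) ^ (card A * card B)"
    using prob_avoids_edges[OF p F] cardF by simp
  also have "\<dots> \<le> exp (- p) ^ (card A * card B)"
    using p exp_ge_add_one_self[of "- p"] by (intro power_mono) auto
  also have "\<dots> = exp (- p * card A * card B)"
    by (simp add: exp_of_nat_mult[symmetric] mult_ac)
  finally show ?thesis .
qed

text \<open>There are at most n^(2s) pairs of sets, each failing with probability at most exp(-p
  s^2), which is at most n^(-3s). For \<open>s\<close> larger than \<open>n\<close> there are no
  such sets.\<close>

lemma prob_not_joined:
  assumes p: "0 \<le> p" "p \<le> 1" and n: "1 \<le> n" and s: "1 \<le> s" and ps: "3 * ln n \<le> p * s"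
  shows "measure_pmf.prob (random_graph n p) {G. \<not> joined {1..n} (snd G) s} \<le> 1 / n"
proof (cases "s \<le> n")
  case sn: True
  let ?M = "random_graph n p"
  define \<S> where "\<S> = {A. A \<subseteq> {1..n} \<and> card A = s}"
  define \<P> where "\<P> = {(A, B) \<in> \<S> \<times> \<S>. A \<inter> B = {}}"
  have finS: "finite \<S>" unfolding \<S>_def by (rule finite_subset[of _ "Pow {1..n}"]) auto
  have finP: "finite \<P>" unfolding \<P>_def by (rule finite_subset[of _ "\<S> \<times> \<S>"]) (use finS in auto)
  have "card \<S> \<le> n ^ s"
    using n_subsets[of "{1..n}" s] binomial_le_pow[OF sn] by (simp add: \<S>_def)
  have "card \<P> \<le> card (\<S> \<times> \<S>)" using finS by (intro card_mono) (auto simp: \<P>_def)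
  also have "\<dots> \<le> n ^ s * n ^ s"
    unfolding card_cartesian_product using \<open>card \<S> \<le> n ^ s\<close> by (intro mult_le_mono)
  finally have cP: "card \<P> \<le> n ^ (2 * s)" by (simp add: mult_2 power_add)
  let ?N = "\<lambda>(A, B). {G :: nat graph. \<not> (\<exists>a\<in>A. \<exists>b\<in>B. {a, b} \<in> snd G)}"
  have "{G. \<not> joined {1..n} (snd G) s} = (\<Union>x\<in>\<P>. ?N x)"
    unfolding joined_def \<P>_def \<S>_def by blast
  then have "measure_pmf.prob ?M {G. \<not> joined {1..n} (snd G) s} \<le> (\<Sum>x\<in>\<P>. measure_pmf.prob ?M (?N x))"
    using finP by (simp add: measure_pmf.finite_measure_subadditive_finite)
  also have "\<dots> \<le> (\<Sum>x\<in>\<P>. 1 / real n ^ (3 * s))"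
  proof (rule sum_mono)
    fix x assume "x \<in> \<P>"
    then obtain A B where x: "x = (A, B)" "A \<subseteq> {1..n}" "B \<subseteq> {1..n}" "A \<inter> B = {}" "card A = s" "card B = s"
      by (auto simp: \<P>_def \<S>_def)
    have "measure_pmf.prob ?M (?N x) \<le> exp (- p * s * s)"
      using prob_no_cross_edge[OF p x(2-4)] x by simp
    also have "\<dots> \<le> exp (- (real (3 * s) * ln n))"
      using mult_right_mono[OF ps, of s] by (simp add: algebra_simps)
    also have "\<dots> = 1 / real n ^ (3 * s)"
      using n by (simp only: exp_minus exp_of_nat_mult) (simp add: inverse_eq_divide)
    finally show "measure_pmf.prob ?M (?N x) \<le> 1 / real n ^ (3 * s)" .
  qed
  also have "\<dots> = card \<P> * (1 / real n ^ (3 * s))" by simp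
  also have "\<dots> \<le> real (n ^ (2 * s)) * (1 / real n ^ (3 * s))"
    using cP by (intro mult_right_mono) auto
  also have "\<dots> = 1 / real n ^ s"
  proof -
    have "3 * s = 2 * s + s" by simp
    then have "real n ^ (3 * s) = real n ^ (2 * s) * real n ^ s" by (metis power_add)
    then show ?thesis using n by simp
  qed
  also have "\<dots> \<le> 1 / n"
    using n s self_le_power[of "real n" s] by (intro divide_left_mono) auto
  finally show ?thesis .
next
  case False
  have "joined {1..n} (snd G) s" for G :: "nat graph"
  proof -
    have "card A \<noteq> s" if "A \<subseteq> {1..n}" for A
      using card_mono[OF _ that] False by auto
    then show ?thesis unfolding joined_def by blast
  qed
  then show ?thesis by simp
qed

text \<open>There are at most n^2 pairs of a vertex and a block, each failing with probability at
  most exp(-p s), which is at most n^(-3).\<close>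

lemma prob_not_block_joined:
  assumes p: "0 \<le> p" "p \<le> 1" and n: "1 \<le> n" and s: "1 \<le> s" and ps: "3 * ln n \<le> p * s"
  shows "measure_pmf.prob (random_graph n p) {G. \<not> block_joined n (snd G) s} \<le> 1 / n"
proof -
  let ?M = "random_graph n p"
  define \<P> where "\<P> = {(v, j). v \<in> {1..n} \<and> Suc j * s \<le> n \<and> v \<notin> block s j}"
  have sub: "\<P> \<subseteq> {1..n} \<times> {..<n}"
  proof (clarsimp simp: \<P>_def)
    fix j assume "s + j * s \<le> n"
    moreover have "j \<le> j * s" using s by simp
    ultimately show "j < n" using s by linarith
  qed
  have finP: "finite \<P>" using sub by (rule finite_subset) simp
  have "card \<P> \<le> card ({1..n} \<times> {..<n})" using sub by (intro card_mono) auto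
  then have cP: "card \<P> \<le> n * n" by simp
  let ?N = "\<lambda>(v, j). {G :: nat graph. \<not> (\<exists>a\<in>{v}. \<exists>b\<in>block s j. {a, b} \<in> snd G)}"
  have "{G. \<not> block_joined n (snd G) s} = (\<Union>x\<in>\<P>. ?N x)"
    unfolding block_joined_def \<P>_def by blast
  then have "measure_pmf.prob ?M {G. \<not> block_joined n (snd G) s} \<le> (\<Sum>x\<in>\<P>. measure_pmf.prob ?M (?N x))"
    using finP by (simp add: measure_pmf.finite_measure_subadditive_finite)
  also have "\<dots> \<le> (\<Sum>x\<in>\<P>. 1 / real n ^ 3)"
  proof (rule sum_mono)
    fix x assume "x \<in> \<P>"
    then obtain v j where x: "x = (v, j)" "v \<in> {1..n}" "Suc j * s \<le> n" "v \<notin> block s j"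
      by (auto simp: \<P>_def)
    have cb: "card (block s j) = s" by (simp add: block_def)
    have "block s j \<subseteq> {1..n}" using x(3) by (auto simp: block_def)
    then have "measure_pmf.prob ?M (?N x) \<le> exp (- p * s)"
      using prob_no_cross_edge[OF p, of "{v}" n "block s j"] x cb by simp
    also have "\<dots> \<le> exp (- (real 3 * ln n))" using ps by simp
    also have "\<dots> = 1 / real n ^ 3"
      using n by (simp only: exp_minus exp_of_nat_mult) (simp add: inverse_eq_divide)
    finally show "measure_pmf.prob ?M (?N x) \<le> 1 / real n ^ 3" .
  qed
  also have "\<dots> = card \<P> * (1 / real n ^ 3)" by simp
  also have "\<dots> \<le> real (n * n) * (1 / real n ^ 3)"
    using cP by (intro mult_right_mono of_nat_mono) auto
  also have "\<dots> = 1 / n" using n by (simp add: power3_eq_cube)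
  finally show ?thesis .
qed

lemma prob_joined_and_block_joined:
  assumes p: "0 \<le> p" "p \<le> 1" and n: "1 \<le> n" and s: "1 \<le> s" and ps: "3 * ln n \<le> p * s"
  shows "1 - 2 / n \<le> measure_pmf.prob (random_graph n p)
    {G. joined {1..n} (snd G) s \<and> block_joined n (snd G) s}"
proof -
  let ?M = "random_graph n p"
  let ?J = "{G. \<not> joined {1..n} (snd G) s}" and ?K = "{G. \<not> block_joined n (snd G) s}"
  have eq: "{G. joined {1..n} (snd G) s \<and> block_joined n (snd G) s} = UNIV - (?J \<union> ?K)" by blast
  have "measure_pmf.prob ?M {G. joined {1..n} (snd G) s \<and> block_joined n (snd G) s}
      = 1 - measure_pmf.prob ?M (?J \<union> ?K)"
    unfolding eq using measure_pmf.prob_compl[of "?J \<union> ?K" ?M] by simp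
  moreover have "measure_pmf.prob ?M (?J \<union> ?K) \<le> 1 / n + 1 / n"
    using measure_Un_le[of ?J "measure_pmf ?M" ?K]
      prob_not_joined[OF assms] prob_not_block_joined[OF assms] by simp
  ultimately show ?thesis by simp
qed

section \<open>Almost all trees\<close>

definition good_parent_funs :: "nat \<Rightarrow> nat \<Rightarrow> nat \<Rightarrow> (nat \<Rightarrow> nat) set" where
  "good_parent_funs n \<Delta> g = {f \<in> parent_funs {1..n} 1.
     (\<forall>v\<in>{1..n}. card (children {1..n} 1 f v) \<le> \<Delta>) \<and> g \<le> card (twigs {1..n} 1 f)}"

lemma universal_for_good_trees:
  assumes n: "1 \<le> n" and s: "0 < s" and joined: "joined {1..n} E s" and blocks: "block_joined n E s"
    and size: "(3 * s + 5 + \<Delta> * s) * s \<le> g"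
  shows "universal_for ({1..n}, E) (parent_tree {1..n} 1 ` good_parent_funs n \<Delta> g)"
  unfolding universal_for_def
proof (rule ballI, elim imageE)
  fix T f assume T: "T = parent_tree {1..n} 1 f" and "f \<in> good_parent_funs n \<Delta> g"
  then have f: "f \<in> parent_funs {1..n} 1" and deg: "\<And>v. v \<in> {1..n} \<Longrightarrow> card (children {1..n} 1 f v) \<le> \<Delta>"
    and tw: "g \<le> card (twigs {1..n} 1 f)" by (auto simp: good_parent_funs_def)
  \<comment> \<open>The reserved sets consist of \<open>2 * s + 1\<close>, \<open>s + 1\<close> and
    \<open>\<Delta> * s + 2\<close> blocks. In each, one block may be lost to \<open>v\<close>; the
    further one in the last set gives the strict inequality.\<close>
  define a where "a = 2 * s + 1"
  define b where "b = 3 * s + 2"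
  define c where "c = 3 * s + 4 + \<Delta> * s"
  have "card (twigs {1..n} 1 f) \<le> card {1..n}" by (intro card_mono) (auto simp: twigs_def)
  then have tn: "card (twigs {1..n} 1 f) \<le> n" by simp
  have ab: "a \<le> b" "b \<le> c" by (simp_all add: a_def b_def c_def)
  then have abc: "a * s \<le> b * s" "b * s \<le> c * s" by (simp_all only: mult_le_mono1)
  have size': "c * s + s \<le> card (twigs {1..n} 1 f)"
    using size tw by (simp add: c_def algebra_simps)
  have cn: "a * s \<le> n" "b * s \<le> n" "c * s \<le> n" using abc size' tn by linarith+
  let ?X = "{0 * s<..a * s}" and ?Y = "{a * s<..b * s}" and ?Z = "{b * s<..c * s}"
  show "contains_copy ({1..n}, E) T"
    unfolding T
  proof (rule contains_copy_parent_tree[where X = ?X and Y = ?Y and Z = ?Z and s = s and \<Delta> = \<Delta>])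
    show "2 * s \<le> card {x \<in> ?X. {v, x} \<in> E}" if "v \<in> {1..n}" for v
      using card_neighbours_in_blocks[OF blocks s cn(1) that, of 0] by (simp add: a_def)
    show "s \<le> card {x \<in> ?Y. {v, x} \<in> E}" if "v \<in> {1..n}" for v
      using card_neighbours_in_blocks[OF blocks s cn(2) that, of a] by (simp add: a_def b_def)
    show "\<Delta> * s < card {x \<in> ?Z. {v, x} \<in> E}" if "v \<in> {1..n}" for v
      using card_neighbours_in_blocks[OF blocks s cn(3) that, of b] by (simp add: b_def c_def)
    show "card ?X + card ?Y + card ?Z + s \<le> card (twigs {1..n} 1 f)"
      using size' abc by simp
    have "a * s + \<Delta> * s \<le> c * s"
    proof -
      have "\<Delta> \<le> \<Delta> * s" using s by simp
      then have "a + \<Delta> \<le> c" unfolding a_def c_def by linarith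
      then show ?thesis unfolding add_mult_distrib[symmetric] by (rule mult_le_mono1)
    qed
    then show "card ?X + \<Delta> * s < card (twigs {1..n} 1 f)" using size' s by simp
  qed (use n f joined deg cn ab in auto)
qed

lemma prob_universal_for_good_trees:
  assumes p: "0 \<le> p" "p \<le> 1" and n: "1 \<le> n" and s: "1 \<le> s" and ps: "3 * ln n \<le> p * s"
    and size: "(3 * s + 5 + \<Delta> * s) * s \<le> g"
  shows "1 - 2 / n \<le> measure_pmf.prob (random_graph n p)
    {G. universal_for G (parent_tree {1..n} 1 ` good_parent_funs n \<Delta> g)}"
proof -
  \<comment> \<open>The vertex set is known only on the support, so monotonicity is applied almost
    everywhere.\<close>
  have V: "fst G = {1..n}" if "G \<in> set_pmf (random_graph n p)" for G
    using that by (auto simp: random_graph_def)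
  have "1 - 2 / n \<le> measure_pmf.prob (random_graph n p) {G. joined {1..n} (snd G) s \<and> block_joined n (snd G) s}"
    by (rule prob_joined_and_block_joined[OF p n s ps])
  also have "\<dots> \<le> measure_pmf.prob (random_graph n p)
    {G. universal_for G (parent_tree {1..n} 1 ` good_parent_funs n \<Delta> g)}"
  proof (rule measure_pmf.finite_measure_mono_AE)
    show "AE G in random_graph n p. G \<in> {G. joined {1..n} (snd G) s \<and> block_joined n (snd G) s} \<longrightarrow>
        G \<in> {G. universal_for G (parent_tree {1..n} 1 ` good_parent_funs n \<Delta> g)}"
      unfolding AE_measure_pmf_iff
    proof (intro ballI impI CollectI)
      fix G assume G: "G \<in> set_pmf (random_graph n p)"
        "G \<in> {G. joined {1..n} (snd G) s \<and> block_joined n (snd G) s}"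
      have "universal_for ({1..n}, snd G) (parent_tree {1..n} 1 ` good_parent_funs n \<Delta> g)"
        using G(2) s size by (intro universal_for_good_trees[OF n]) auto
      then show "universal_for G (parent_tree {1..n} 1 ` good_parent_funs n \<Delta> g)"
        using V[OF G(1)] by (metis prod.collapse)
    qed
  qed simp
  finally show ?thesis .
qed

text \<open>A bad function has at most \<open>J\<close> leaves, or at least \<open>J\<close> leaves
  but at most \<open>g\<close> twigs, or a vertex with more than \<Delta> children. The three
  summands come from the three switchings.\<close>

lemma card_bad_parent_funs:
  assumes n: "2 \<le> n" and J: "2 * J + 2 < n" "2 \<le> J"
  shows "real (card (parent_funs {1..n} 1) - card (good_parent_funs n \<Delta> g))
    \<le> ((real J + 1) * n / ((real n - 2 - 2 * J) * (real n - 1)) + (real g + 3) * n / (real J * (real J - 1)) + n / fact \<Delta>)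
      * card (parent_funs {1..n} 1)" (is "_ \<le> (?a + ?b + ?c) * _")
proof -
  let ?V = "{1..n}"
  let ?F = "parent_funs ?V 1"
  let ?A = "{f \<in> ?F. card (leaves ?V 1 f) \<le> J}"
  let ?B = "{f \<in> ?F. J \<le> card (leaves ?V 1 f) \<and> card (twigs ?V 1 f) \<le> g}"
  let ?C = "\<lambda>v. {f \<in> ?F. Suc \<Delta> \<le> card (children ?V 1 f v)}"
  have fin: "finite ?F" by (simp add: finite_parent_funs)
  have *: "real (card ?A * ((card ?V - 2 - 2 * J) * (card ?V - 1))) \<le> real (card ?F * ((J + 1) * card ?V))"
    using card_few_leaves[of ?V 1 J] n by (intro of_nat_mono) simp
  have "real (card ?A) * ((real n - 2 - 2 * J) * (real n - 1)) \<le> real (card ?F) * ((real J + 1) * n)"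
  proof -
    have "real (card ?V - 2 - 2 * J) = real n - 2 - 2 * J" "real (card ?V - 1) = real n - 1"
      using n J by (simp_all add: of_nat_diff)
    then show ?thesis using * by (simp only: of_nat_mult of_nat_add of_nat_1 card_atLeastAtMost) simp
  qed
  moreover have "0 < (real n - 2 - 2 * J) * (real n - 1)"
    using n J by (intro mult_pos_pos) linarith+
  ultimately have A: "real (card ?A) \<le> ?a * card ?F"
    by (simp add: pos_le_divide_eq mult_ac)
  have "real (card ?B * (J * (J - 1))) \<le> real (card ?F * ((g + 3) * card ?V))"
    using card_few_twigs[of ?V 1 J g] by (intro of_nat_mono) simp
  then have "real (card ?B) * (real J * (real J - 1)) \<le> real (card ?F) * ((real g + 3) * n)"
    using J by (simp add: of_nat_diff)
  moreover have "0 < real J * (real J - 1)" using J by (intro mult_pos_pos) linarith+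
  ultimately have B: "real (card ?B) \<le> ?b * card ?F"
    by (simp add: pos_le_divide_eq mult_ac)
  have C1: "real (card (?C v)) \<le> 1 / fact \<Delta> * card ?F" if "v \<in> ?V" for v
  proof -
    have "real (card (?C v) * fact \<Delta>) \<le> real (card ?F)"
      using card_many_children[of ?V 1 v \<Delta>] that n by (intro of_nat_mono) simp
    then show ?thesis by (simp add: pos_le_divide_eq)
  qed
  have "real (card (\<Union>v\<in>?V. ?C v)) \<le> real (\<Sum>v\<in>?V. card (?C v))"
    by (intro of_nat_mono card_UN_le) simp
  also have "\<dots> \<le> (\<Sum>v\<in>?V. 1 / fact \<Delta> * card ?F)" unfolding of_nat_sum using C1 by (rule sum_mono)
  also have "\<dots> = ?c * card ?F" by simp
  finally have C: "real (card (\<Union>v\<in>?V. ?C v)) \<le> ?c * card ?F" .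
  have "?F - good_parent_funs n \<Delta> g \<subseteq> ?A \<union> ?B \<union> (\<Union>v\<in>?V. ?C v)"
    by (auto simp: good_parent_funs_def not_le Suc_le_eq)
  then have "card (?F - good_parent_funs n \<Delta> g) \<le> card (?A \<union> ?B \<union> (\<Union>v\<in>?V. ?C v))"
    using fin by (intro card_mono) auto
  also have "\<dots> \<le> card ?A + card ?B + card (\<Union>v\<in>?V. ?C v)"
    by (meson add_le_mono1 card_Un_le le_trans)
  finally have "card (?F - good_parent_funs n \<Delta> g) \<le> card ?A + card ?B + card (\<Union>v\<in>?V. ?C v)" .
  moreover have "card (?F - good_parent_funs n \<Delta> g) = card ?F - card (good_parent_funs n \<Delta> g)"
    using fin by (intro card_Diff_subset) (auto simp: good_parent_funs_def intro: finite_subset)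
  ultimately have "real (card ?F - card (good_parent_funs n \<Delta> g))
      \<le> real (card ?A) + real (card ?B) + real (card (\<Union>v\<in>?V. ?C v))" by linarith
  also have "\<dots> \<le> ?a * card ?F + ?b * card ?F + ?c * card ?F" using A B C by linarith
  finally show ?thesis by (simp only: distrib_right)
qed

theorem theorem2p9:
  shows "\<exists>c::real. c > 0 \<and>
    (\<exists>Tstar :: nat \<Rightarrow> nat graph set.
       (\<forall>n. Tstar n \<subseteq> labeled_trees n) \<and>
       (\<exists>\<epsilon> :: nat \<Rightarrow> real. \<epsilon> \<longlonglongrightarrow> 0 \<and>
          (\<forall>n. real (card (Tstar n)) = (1 - \<epsilon> n) * real (card (labeled_trees n)))) \<and>
       (\<forall>p :: nat \<Rightarrow> real.
          (\<forall>n. 0 \<le> p n \<and> p n \<le> 1) \<longrightarrow>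
          (\<forall>\<^sub>F n in sequentially. p n \<ge> c * real n powr (-1/3) * (ln (real n))\<^sup>2) \<longrightarrow>
          (\<lambda>n. measure_pmf.prob (random_graph n (p n)) {G. universal_for G (Tstar n)})
            \<longlonglongrightarrow> 1))"
proof -
  \<comment> \<open>As 1/6 + 2/3 < 7/8, the reserved sets fit below the number of twigs; 7/8 + 1 < 2
    * 19/20 makes few twigs rare, and 19/20 < 1 makes few leaves rare.\<close>
  define \<Delta> where "\<Delta> = (\<lambda>n::nat. nat \<lceil>real n powr (1/6)\<rceil>)"
  define g where "g = (\<lambda>n::nat. nat \<lceil>real n powr (7/8)\<rceil>)"
  define J where "J = (\<lambda>n::nat. nat \<lceil>real n powr (19/20)\<rceil>)"
  define p0 where "p0 = (\<lambda>n::nat. real n powr (-1/3) * (ln (real n))\<^sup>2)"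
  \<comment> \<open>Taken from the threshold \<open>p0\<close> instead of \<open>p\<close>, so that
    \<open>s\<close> does not depend on \<open>p\<close>. The union bounds ask for
    \<open>p * s\<close> to be at least 3 ln n.\<close>
  define s where "s = (\<lambda>n::nat. nat \<lceil>3 * ln n / p0 n\<rceil>)"
  define good where "good = (\<lambda>n. good_parent_funs n (\<Delta> n) (g n))"
  \<comment> \<open>For \<open>n = 0\<close> there is no tree, since connected graphs are nonempty;
    the default 0 in \<open>\<epsilon>\<close> serves this case.\<close>
  define Tstar where "Tstar = (\<lambda>n. if n = 0 then {} else parent_tree {1..n} 1 ` good n)"
  define \<epsilon> where "\<epsilon> = (\<lambda>n. if card (labeled_trees n) = 0 then 0
    else 1 - real (card (Tstar n)) / real (card (labeled_trees n)))"
  have nat_ceil: "real (nat \<lceil>x\<rceil>) \<le> x + 1" "x \<le> real (nat \<lceil>x\<rceil>)" if "0 \<le> x" for x :: real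
    using that by linarith+
  have \<Delta>: "real (\<Delta> n) \<le> real n powr (1/6) + 1" "real n powr (1/6) \<le> real (\<Delta> n)"
    and g: "real (g n) \<le> real n powr (7/8) + 1" "real n powr (7/8) \<le> real (g n)"
    and J: "real (J n) \<le> real n powr (19/20) + 1" "real n powr (19/20) \<le> real (J n)" for n
    unfolding \<Delta>_def g_def J_def by (rule nat_ceil; simp)+
  have good_sub: "good n \<subseteq> parent_funs {1..n} 1" for n
    by (auto simp: good_def good_parent_funs_def)
  have Tsub: "Tstar n \<subseteq> labeled_trees n" for n
    using good_sub[of n] labeled_trees_eq_parent_trees[of n] by (auto simp: Tstar_def)
  have cards: "card (labeled_trees n) = card (parent_funs {1..n} 1)" "card (Tstar n) = card (good n)"
    if "1 \<le> n" for n
  proof -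
    show "card (labeled_trees n) = card (parent_funs {1..n} 1)"
      unfolding labeled_trees_eq_parent_trees[OF that] by (rule card_image[OF inj_on_parent_tree])
    show "card (Tstar n) = card (good n)"
      using that card_image[OF inj_on_subset[OF inj_on_parent_tree good_sub]] by (simp add: Tstar_def)
  qed
  have finT: "finite (labeled_trees n)" for n
  proof (cases "1 \<le> n")
    case True
    then show ?thesis using labeled_trees_eq_parent_trees[of n] by (simp add: finite_parent_funs)
  next
    case False
    have "labeled_trees 0 = {}"
      by (auto simp: labeled_trees_def is_tree_def connected_graph_def)
    moreover have "n = 0" using False by simp
    ultimately show ?thesis by simp
  qed
  have eq: "real (card (Tstar n)) = (1 - \<epsilon> n) * real (card (labeled_trees n))" for n
  proof (cases "card (labeled_trees n) = 0")
    case True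
    then have "card (Tstar n) = 0" using card_mono[OF finT Tsub, of n] by simp
    then show ?thesis using True by simp
  next
    case False
    then show ?thesis by (simp add: \<epsilon>_def)
  qed
  \<comment> \<open>The bound of \<open>card_bad_parent_funs\<close> with powers for ceilings: each
    ceiling adds at most 1, whence the 2 and the 4s. The factorial gives way to an
    exponential.\<close>
  define \<delta> where "\<delta> = (\<lambda>n::nat. (real n powr (19/20) + 2) * n
      / ((real n - 4 - 2 * real n powr (19/20)) * (real n - 1))
    + (real n powr (7/8) + 4) * n / (real n powr (19/20) * (real n powr (19/20) - 1))
    + 2 * real n / 2 powr (real n powr (1/6)))"
  have lim: "\<delta> \<longlonglongrightarrow> 0" unfolding \<delta>_def by real_asymp
  have "\<epsilon> \<longlonglongrightarrow> 0"
  proof (rule tendsto_sandwich[OF _ _ tendsto_const lim])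
    have "0 \<le> \<epsilon> n" for n
      using card_mono[OF finT Tsub, of n] by (auto simp: \<epsilon>_def divide_le_eq_1)
    then show "\<forall>\<^sub>F n in sequentially. 0 \<le> \<epsilon> n" by simp
    have "\<forall>\<^sub>F n in sequentially. 2 * real n powr (19/20) + 4 < real n" by real_asymp
    moreover have "\<forall>\<^sub>F n in sequentially. 2 \<le> real n powr (19/20)" by real_asymp
    ultimately show "\<forall>\<^sub>F n in sequentially. \<epsilon> n \<le> \<delta> n"
      using eventually_ge_at_top[of 2]
    proof eventually_elim
      case (elim n)
      let ?N = "real (card (parent_funs {1..n} 1))"
      have "real (2 * J n + 2) < real n" "real 2 \<le> real (J n)"
        using elim(1,2) J[of n] by simp_all
      then have J': "2 * J n + 2 < n" "2 \<le> J n" by (simp_all only: of_nat_less_iff of_nat_le_iff)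
      have D: "real n / fact (\<Delta> n) \<le> 2 * real n / 2 powr (real n powr (1/6))"
      proof -
        have pow: "(2::real) ^ k \<le> 2 * fact k" for k
        proof (induction k)
          case (Suc k)
          show ?case
          proof (cases "k = 0")
            case False
            have "(2::real) * 2 ^ k \<le> (1 + real k) * (2 * fact k)"
              by (rule mult_mono) (use Suc.IH False in auto)
            then show ?thesis by simp
          qed simp
        qed simp
        have "2 powr (real n powr (1/6)) \<le> 2 powr (real (\<Delta> n))" using \<Delta>(2)[of n] by simp
        also have "\<dots> \<le> 2 * fact (\<Delta> n)" using pow[of "\<Delta> n"] by (simp add: powr_realpow)
        finally have "2 powr (real n powr (1/6)) \<le> 2 * fact (\<Delta> n)" .
        then have "2 * real n / (2 * fact (\<Delta> n)) \<le> 2 * real n / 2 powr (real n powr (1/6))"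
          by (intro divide_left_mono) auto
        then show ?thesis by simp
      qed
      have "(j + 1) * m / ((m - 2 - 2 * j) * (m - 1)) \<le> (a + 2) * m / ((m - 4 - 2 * a) * (m - 1))"
        if "2 * a + 4 < m" "2 \<le> a" "a \<le> j" "j \<le> a + 1" for a j m :: real
        using that by (intro frac_le mult_mono mult_pos_pos mult_nonneg_nonneg) linarith+
      from this[of "real n powr (19/20)" "real n" "real (J n)"]
      have A: "(real (J n) + 1) * n / ((real n - 2 - 2 * J n) * (real n - 1))
          \<le> (real n powr (19/20) + 2) * n / ((real n - 4 - 2 * real n powr (19/20)) * (real n - 1))"
        using J[of n] elim(1,2) by simp
      have "(k + 3) * m / (j * (j - 1)) \<le> (b + 4) * m / (a * (a - 1))"
        if "0 \<le> m" "2 \<le> a" "a \<le> j" "0 \<le> k" "k \<le> b + 1" for a b j k m :: real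
        using that by (intro frac_le mult_mono mult_pos_pos mult_nonneg_nonneg) linarith+
      from this[of "real n" "real n powr (19/20)" "real (J n)" "real (g n)" "real n powr (7/8)"]
      have B: "(real (g n) + 3) * n / (real (J n) * (real (J n) - 1))
          \<le> (real n powr (7/8) + 4) * n / (real n powr (19/20) * (real n powr (19/20) - 1))"
        using J[of n] g[of n] elim(2) by simp
      have "real (card (parent_funs {1..n} 1) - card (good n)) \<le> \<delta> n * ?N"
        unfolding good_def
        by (rule order.trans[OF card_bad_parent_funs[OF elim(3) J']])
          (use A B D in \<open>auto simp: \<delta>_def intro!: mult_right_mono add_mono\<close>)
      then have "?N - real (card (good n)) \<le> \<delta> n * ?N" by linarith
      then show ?case
      proof (cases "card (labeled_trees n) = 0")
        case True
        have "0 \<le> \<delta> n" unfolding \<delta>_def using elim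
          by (intro add_nonneg_nonneg divide_nonneg_nonneg mult_nonneg_nonneg) simp_all
        then show ?thesis using True by (simp add: \<epsilon>_def)
      next
        case False
        then have "0 < ?N" using cards(1) elim(3) by simp
        then have "1 - real (card (good n)) / ?N \<le> \<delta> n"
          using \<open>?N - real (card (good n)) \<le> \<delta> n * ?N\<close> by (simp add: field_simps)
        then show ?thesis using False cards[of n] elim(3) by (simp add: \<epsilon>_def)
      qed
    qed
  qed
  \<comment> \<open>The constant \<open>c = 1\<close> suffices because the factor 3 has been put
    into \<open>s\<close>.\<close>
  moreover have "(\<lambda>n. measure_pmf.prob (random_graph n (p n)) {G. universal_for G (Tstar n)}) \<longlonglongrightarrow> 1"
    if p01: "\<forall>n. 0 \<le> p n \<and> p n \<le> 1"
      and plarge: "\<forall>\<^sub>F n in sequentially. p n \<ge> 1 * real n powr (-1/3) * (ln (real n))\<^sup>2" for p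
  proof (rule tendsto_sandwich[OF _ _ _ tendsto_const])
    have "\<forall>\<^sub>F n in sequentially. 3 * ln (real n) / p0 n + 1 \<le> real n powr (1/3)"
      unfolding p0_def by real_asymp
    moreover have "\<forall>\<^sub>F n in sequentially. (3 * real n powr (1/3) + 5 + (real n powr (1/6) + 1) * real n powr (1/3))
        * real n powr (1/3) \<le> real n powr (7/8)" by real_asymp
    ultimately show "\<forall>\<^sub>F n in sequentially. 1 - 2 / real n
        \<le> measure_pmf.prob (random_graph n (p n)) {G. universal_for G (Tstar n)}"
      using eventually_ge_at_top[of 3] plarge
    proof eventually_elim
      case (elim n)
      have ln: "0 < ln (real n)" using elim by simp
      have p0: "0 < p0 n" "p0 n \<le> p n" using elim ln by (simp_all add: p0_def)
      have "0 < 3 * ln (real n) / p0 n" using ln p0 by simp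
      then have s: "real (s n) \<le> 3 * ln (real n) / p0 n + 1" "3 * ln (real n) / p0 n \<le> real (s n)" "1 \<le> s n"
        unfolding s_def by linarith+
      have "3 * ln n \<le> p0 n * s n" using s(2) p0(1) by (simp add: divide_le_eq mult.commute)
      also have "\<dots> \<le> p n * s n" using p0(2) by (intro mult_right_mono) auto
      finally have ps: "3 * ln n \<le> p n * s n" .
      have s3: "real (s n) \<le> real n powr (1/3)" using s(1) elim by linarith
      have "real ((3 * s n + 5 + \<Delta> n * s n) * s n) = (3 * real (s n) + 5 + real (\<Delta> n) * real (s n)) * real (s n)"
        by simp
      also have "\<dots> \<le> (3 * real n powr (1/3) + 5 + (real n powr (1/6) + 1) * real n powr (1/3)) * real n powr (1/3)"
        using s3 \<Delta>(1)[of n] by (intro mult_mono add_mono) auto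
      also have "\<dots> \<le> real (g n)" using elim g(2)[of n] by linarith
      finally have "(3 * s n + 5 + \<Delta> n * s n) * s n \<le> g n" by (simp only: of_nat_le_iff)
      then show ?case
        using prob_universal_for_good_trees[of "p n" n "s n" "\<Delta> n" "g n"] p01 ps s(3) elim(3)
        by (simp add: Tstar_def good_def)
    qed
    show "(\<lambda>n. 1 - 2 / real n) \<longlonglongrightarrow> 1" by real_asymp
  qed (simp add: measure_pmf.prob_le_1)
  ultimately show ?thesis using Tsub eq
    by (intro exI[of _ 1] conjI exI[of _ Tstar] exI[of _ \<epsilon>] allI impI) auto
qed

end
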